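(* Let $J$ be any nonselfadjoint Jacobi operator in $l_2(\mathbb{N})$. There is only one basis of representation for $J$, modulo reflection, with respect to which $J$ has a Jacobi matrix as its matrix representation. Here reflection means that every element of the orthonormal basis is multiplied by $-1$. The Jacobi matrix representing a nonselfadjoint Jacobi operator is unique.
   Context: Hilbert spaces are complex; inner products are antilinear in the first argument; $\mathbb{N}=\{1,2,\dots\}$. Basis of representation: an orthonormal basis $\{u_k\}_{k=1}^\infty$ of a Hilbert space is a basis of representation for a closed operator $A$ if (a) $u_k\in\operatorname{dom}A$ for all $k$, and (b) every closed operator $B$ with $Bu_k=Au_k$ for all $k$ satisfies $B\supset A$. Then the matrix with entries $a_{kj}=\langle u_k,Au_j\rangle$ is the matrix representation of $A$ with respect to $\{u_k\}$. Jacobi matrix: a semi-infinite tridiagonal matrix with real diagonal entries $q_1,q_2,\dots$ and with positive entries $b_1,b_2,\dots$ on both the sub- and superdiagonal (entries $(k,k+1)$ and $(k+1,k)$ equal to $b_k$), all other entries being zero. Jacobi operator: given a Jacobi matrix, the associated Jacobi operator $J$ is the unique closed symmetric operator in $l_2(\mathbb{N})$ having this matrix as its matrix representation with respect to the canonical basis $\{\delta_k\}_{k=1}^\infty$; i.e. $J$ is the closure of the operator defined on finitely supported sequences by $(J_0\phi)_1=q_1\phi_1+b_1\phi_2$, $(J_0\phi)_k=b_{k-1}\phi_{k-1}+q_k\phi_k+b_k\phi_{k+1}$ for $k\ge2$.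
   Formalization: In the complex space the basis is unique only up to one common factor c with |c|=1 (e.g. multiplying by i keeps the matrix); this is what is proved, with uniqueness modulo reflection (factor -1) asserted for bases consisting of real sequences. *)

theory Defs
  imports "HOL-Analysis.Analysis"
begin

section \<open>The complex Hilbert space of square-summable sequences\<close>

text \<open>
  Sequences are indexed by \<open>nat\<close>, so the index \<open>k\<close> here stands for the index
  \<open>k + 1\<close> of the set \<open>{1, 2, \<dots>}\<close>.
\<close>

definition square_summable :: "(nat \<Rightarrow> complex) \<Rightarrow> bool" where
  "square_summable x \<longleftrightarrow> summable (\<lambda>k. (cmod (x k))\<^sup>2)"

lemma square_summable_zero: "square_summable (\<lambda>k. 0)"
  by (simp add: square_summable_def)

lemma square_summable_scale:
  assumes "square_summable x"
  shows "square_summable (\<lambda>k. c * x k)"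
  using summable_mult[OF assms[unfolded square_summable_def], of "(cmod c)\<^sup>2"]
  by (simp add: square_summable_def norm_mult power_mult_distrib)

lemma square_summable_add:
  assumes "square_summable x" "square_summable y"
  shows "square_summable (\<lambda>k. x k + y k)"
proof -
  have le: "(cmod (x k + y k))\<^sup>2 \<le> 2 * (cmod (x k))\<^sup>2 + 2 * (cmod (y k))\<^sup>2" for k
  proof -
    have "(cmod (x k + y k))\<^sup>2 \<le> (cmod (x k) + cmod (y k))\<^sup>2"
      by (intro power_mono norm_triangle_ineq) auto
    also have "\<dots> \<le> 2 * (cmod (x k))\<^sup>2 + 2 * (cmod (y k))\<^sup>2"
      using sum_squares_bound[of "cmod (x k)" "cmod (y k)"] by (simp add: power2_sum)
    finally show ?thesis .
  qed
  have sm: "summable (\<lambda>k. 2 * (cmod (x k))\<^sup>2 + 2 * (cmod (y k))\<^sup>2)"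
    using assms unfolding square_summable_def by (intro summable_add summable_mult)
  show ?thesis
    unfolding square_summable_def
    by (rule summable_comparison_test'[where N = 0, OF sm]) (simp add: le)
qed

lemma summable_cnj_mult:
  assumes "square_summable x" "square_summable y"
  shows "summable (\<lambda>k. cnj (x k) * y k)"
proof -
  have le: "norm (cnj (x k) * y k) \<le> (cmod (x k))\<^sup>2 + (cmod (y k))\<^sup>2" for k
  proof -
    have "2 * cmod (x k) * cmod (y k) \<le> (cmod (x k))\<^sup>2 + (cmod (y k))\<^sup>2"
      by (rule sum_squares_bound)
    moreover have "0 \<le> cmod (x k) * cmod (y k)"
      by simp
    ultimately show ?thesis
      unfolding norm_mult complex_mod_cnj by linarith
  qed
  have sm: "summable (\<lambda>k. (cmod (x k))\<^sup>2 + (cmod (y k))\<^sup>2)"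
    using assms unfolding square_summable_def by (intro summable_add)
  show ?thesis
    by (rule summable_comparison_test'[where N = 0, OF sm]) (rule le)
qed

typedef ell2 = "{x. square_summable x}"
  morphisms coord Abs_ell2
  using square_summable_zero by blast

setup_lifting type_definition_ell2

lemma square_summable_coord: "square_summable (coord x)"
  using coord[of x] by simp

definition cinner_ell2 :: "ell2 \<Rightarrow> ell2 \<Rightarrow> complex" where
  "cinner_ell2 x y = (\<Sum>k. cnj (coord x k) * coord y k)"

lift_definition scale_ell2 :: "complex \<Rightarrow> ell2 \<Rightarrow> ell2" is "\<lambda>c x k. c * x k"
  by (rule square_summable_scale)

instantiation ell2 :: real_inner
begin

lift_definition zero_ell2 :: ell2 is "\<lambda>k. 0"
  by (rule square_summable_zero)

lift_definition plus_ell2 :: "ell2 \<Rightarrow> ell2 \<Rightarrow> ell2" is "\<lambda>x y k. x k + y k"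
  by (rule square_summable_add)

lift_definition uminus_ell2 :: "ell2 \<Rightarrow> ell2" is "\<lambda>x k. - x k"
  by (simp add: square_summable_def)

definition minus_ell2 :: "ell2 \<Rightarrow> ell2 \<Rightarrow> ell2" where
  "x - y = x + - (y :: ell2)"

definition scaleR_ell2 :: "real \<Rightarrow> ell2 \<Rightarrow> ell2" where
  "scaleR_ell2 r x = scale_ell2 (complex_of_real r) x"

definition inner_ell2 :: "ell2 \<Rightarrow> ell2 \<Rightarrow> real" where
  "inner_ell2 x y = Re (cinner_ell2 x y)"

definition norm_ell2 :: "ell2 \<Rightarrow> real" where
  "norm_ell2 x = sqrt (inner x x)"

definition sgn_ell2 :: "ell2 \<Rightarrow> ell2" where
  "sgn_ell2 x = scaleR (inverse (norm x)) x"

definition dist_ell2 :: "ell2 \<Rightarrow> ell2 \<Rightarrow> real" where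
  "dist_ell2 x y = norm (x - y)"

definition uniformity_ell2 :: "(ell2 \<times> ell2) filter" where
  "uniformity_ell2 = (INF e\<in>{0<..}. principal {(x, y). dist x y < e})"

definition open_ell2 :: "ell2 set \<Rightarrow> bool" where
  "open_ell2 U \<longleftrightarrow> (\<forall>x\<in>U. eventually (\<lambda>(x', y). x' = x \<longrightarrow> y \<in> U) uniformity)"

instance
proof
  fix x y z :: ell2 and r s :: real
  show "x + y + z = x + (y + z)" by transfer (simp add: add.assoc)
  show "x + y = y + x" by transfer (simp add: add.commute)
  show "0 + x = x" by transfer simp
  show "- x + x = 0" by transfer simp
  show "x - y = x + - y" by (rule minus_ell2_def)
  show "r *\<^sub>R (x + y) = r *\<^sub>R x + r *\<^sub>R y"
    unfolding scaleR_ell2_def by transfer (simp add: algebra_simps)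
  show "(r + s) *\<^sub>R x = r *\<^sub>R x + s *\<^sub>R x"
    unfolding scaleR_ell2_def by transfer (simp add: algebra_simps)
  show "r *\<^sub>R s *\<^sub>R x = (r * s) *\<^sub>R x"
    unfolding scaleR_ell2_def by transfer (simp add: algebra_simps)
  show "1 *\<^sub>R x = x"
    unfolding scaleR_ell2_def by transfer simp
  show "sgn x = inverse (norm x) *\<^sub>R x" by (rule sgn_ell2_def)
  show "dist x y = norm (x - y)" by (rule dist_ell2_def)
  show "uniformity = (INF e\<in>{0<..}. principal {(x, y :: ell2). dist x y < e})"
    by (rule uniformity_ell2_def)
  show "open U \<longleftrightarrow> (\<forall>x\<in>U. eventually (\<lambda>(x', y). x' = x \<longrightarrow> y \<in> U) uniformity)"
    for U :: "ell2 set"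
    by (rule open_ell2_def)
  show "norm x = sqrt (inner x x)" by (rule norm_ell2_def)
  have sm: "summable (\<lambda>k. cnj (coord u k) * coord v k)" for u v
    by (intro summable_cnj_mult square_summable_coord)
  have inner_sum: "inner u v = (\<Sum>k. Re (cnj (coord u k) * coord v k))" for u v :: ell2
    unfolding inner_ell2_def cinner_ell2_def by (rule Re_suminf[OF sm])
  have smr: "summable (\<lambda>k. Re (cnj (coord u k) * coord v k))" for u v
    by (rule summable_Re[OF sm])
  show "inner x y = inner y x"
    unfolding inner_sum by (simp add: mult.commute)
  have "inner (x + y) z
      = (\<Sum>k. Re (cnj (coord x k) * coord z k) + Re (cnj (coord y k) * coord z k))"
    unfolding inner_sum plus_ell2.rep_eq by (simp add: algebra_simps)
  also have "\<dots> = inner x z + inner y z"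
    unfolding inner_sum by (rule suminf_add[OF smr smr, symmetric])
  finally show "inner (x + y) z = inner x z + inner y z" .
  have "inner (r *\<^sub>R x) y = (\<Sum>k. r * Re (cnj (coord x k) * coord y k))"
    unfolding inner_sum scaleR_ell2_def scale_ell2.rep_eq by (simp add: algebra_simps)
  also have "\<dots> = r * inner x y"
    unfolding inner_sum by (rule suminf_mult[OF smr])
  finally show "inner (r *\<^sub>R x) y = r * inner x y" .
  have nonneg: "0 \<le> Re (cnj (coord x k) * coord x k)" for k
    by simp
  show "0 \<le> inner x x"
    unfolding inner_sum by (rule suminf_nonneg[OF smr nonneg])
  have "inner x x = 0 \<longleftrightarrow> (\<forall>k. Re (cnj (coord x k) * coord x k) = 0)"
    unfolding inner_sum by (rule suminf_eq_zero_iff[OF smr nonneg])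
  also have "\<dots> \<longleftrightarrow> (\<forall>k. coord x k = 0)"
    by (simp add: complex_eq_iff sum_squares_eq_zero_iff)
  also have "\<dots> \<longleftrightarrow> x = 0"
    by transfer auto
  finally show "inner x x = 0 \<longleftrightarrow> x = 0" .
qed

end

interpretation ell2: vector_space scale_ell2
proof
  fix c d :: complex and x y :: ell2
  show "scale_ell2 c (x + y) = scale_ell2 c x + scale_ell2 c y"
    by transfer (simp add: distrib_left)
  show "scale_ell2 (c + d) x = scale_ell2 c x + scale_ell2 d x"
    by transfer (simp add: distrib_right)
  show "scale_ell2 c (scale_ell2 d x) = scale_ell2 (c * d) x"
    by transfer (simp add: mult.assoc)
  show "scale_ell2 1 x = x"
    by transfer simp
qed

lift_definition delta :: "nat \<Rightarrow> ell2" is "\<lambda>k n. if n = k then 1 else 0"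
proof -
  fix k :: nat
  show "square_summable (\<lambda>n. if n = k then 1 else 0)"
    unfolding square_summable_def by (rule summable_finite[where N = "{k}"]) simp_all
qed

section \<open>Unbounded operators\<close>

text \<open>
  A possibly unbounded operator is represented by its graph. Thus the domain is
  \<^const>\<open>Domain\<close>, and \<open>B \<supset> A\<close> in the sense of operator extension is inclusion of graphs.
\<close>

type_synonym ell2_graph = "(ell2 \<times> ell2) set"

definition is_operator :: "ell2_graph \<Rightarrow> bool" where
  "is_operator A \<longleftrightarrow>
     (0, 0) \<in> A \<and>
     (\<forall>x y x' y'. (x, y) \<in> A \<longrightarrow> (x', y') \<in> A \<longrightarrow> (x + x', y + y') \<in> A) \<and>
     (\<forall>c x y. (x, y) \<in> A \<longrightarrow> (scale_ell2 c x, scale_ell2 c y) \<in> A) \<and>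
     single_valued A"

definition closed_operator :: "ell2_graph \<Rightarrow> bool" where
  "closed_operator A \<longleftrightarrow> is_operator A \<and> closed A"

definition op_apply :: "ell2_graph \<Rightarrow> ell2 \<Rightarrow> ell2" where
  "op_apply A x = (THE y. (x, y) \<in> A)"

text \<open>For a densely defined operator \<open>A\<close> this is the graph of the adjoint operator.\<close>

definition adjoint_graph :: "ell2_graph \<Rightarrow> ell2_graph" where
  "adjoint_graph A = {(x, y). \<forall>(u, v)\<in>A. cinner_ell2 x v = cinner_ell2 y u}"

definition self_adjoint :: "ell2_graph \<Rightarrow> bool" where
  "self_adjoint A \<longleftrightarrow> adjoint_graph A = A"

section \<open>Bases of representation\<close>

text \<open>The span is the complex one, the closure is taken in norm.\<close>

definition orthonormal_basis :: "(nat \<Rightarrow> ell2) \<Rightarrow> bool" where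
  "orthonormal_basis u \<longleftrightarrow>
     (\<forall>j k. cinner_ell2 (u j) (u k) = (if j = k then 1 else 0)) \<and>
     closure (ell2.span (range u)) = UNIV"

definition basis_of_representation :: "ell2_graph \<Rightarrow> (nat \<Rightarrow> ell2) \<Rightarrow> bool" where
  "basis_of_representation A u \<longleftrightarrow>
     closed_operator A \<and> orthonormal_basis u \<and>
     (\<forall>k. u k \<in> Domain A) \<and>
     (\<forall>B. closed_operator B \<and>
          (\<forall>k. u k \<in> Domain B \<and> op_apply B (u k) = op_apply A (u k)) \<longrightarrow> A \<subseteq> B)"

definition matrix_representation ::
    "ell2_graph \<Rightarrow> (nat \<Rightarrow> ell2) \<Rightarrow> nat \<Rightarrow> nat \<Rightarrow> complex" where
  "matrix_representation A u = (\<lambda>k j. cinner_ell2 (u k) (op_apply A (u j)))"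

section \<open>Jacobi matrices and Jacobi operators\<close>

definition tridiagonal :: "(nat \<Rightarrow> real) \<Rightarrow> (nat \<Rightarrow> real) \<Rightarrow> nat \<Rightarrow> nat \<Rightarrow> complex" where
  "tridiagonal q b = (\<lambda>k j.
     if k = j then complex_of_real (q k)
     else if j = Suc k then complex_of_real (b k)
     else if k = Suc j then complex_of_real (b j)
     else 0)"

definition jacobi_matrix :: "(nat \<Rightarrow> nat \<Rightarrow> complex) \<Rightarrow> bool" where
  "jacobi_matrix M \<longleftrightarrow> (\<exists>q b. (\<forall>k. 0 < b k) \<and> M = tridiagonal q b)"

definition jacobi_row :: "(nat \<Rightarrow> real) \<Rightarrow> (nat \<Rightarrow> real) \<Rightarrow> ell2 \<Rightarrow> nat \<Rightarrow> complex" where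
  "jacobi_row q b \<phi> k =
     (if k = 0 then 0 else complex_of_real (b (k - 1)) * coord \<phi> (k - 1)) +
     complex_of_real (q k) * coord \<phi> k + complex_of_real (b k) * coord \<phi> (Suc k)"

definition jacobi_graph0 :: "(nat \<Rightarrow> real) \<Rightarrow> (nat \<Rightarrow> real) \<Rightarrow> ell2_graph" where
  "jacobi_graph0 q b = {(\<phi>, \<psi>). finite {k. coord \<phi> k \<noteq> 0} \<and>
     (\<forall>k. coord \<psi> k = jacobi_row q b \<phi> k)}"

definition jacobi_operator :: "ell2_graph \<Rightarrow> bool" where
  "jacobi_operator J \<longleftrightarrow> (\<exists>q b. (\<forall>k. 0 < b k) \<and> J = closure (jacobi_graph0 q b))"

definition jacobi_basis :: "ell2_graph \<Rightarrow> (nat \<Rightarrow> ell2) \<Rightarrow> bool" where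
  "jacobi_basis J u \<longleftrightarrow>
     basis_of_representation J u \<and> jacobi_matrix (matrix_representation J u)"

lemma coord_diff: "coord (x - y) k = coord x k - coord y k"
  unfolding minus_ell2_def plus_ell2.rep_eq uminus_ell2.rep_eq by simp

lemma coord_sum: "coord (sum f A) k = (\<Sum>a\<in>A. coord (f a) k)"
  by (induction A rule: infinite_finite_induct) (simp_all add: zero_ell2.rep_eq plus_ell2.rep_eq)

lemma ell2_eqI: "(\<And>k. coord x k = coord y k) \<Longrightarrow> x = y"
  by (rule coord_inject[THEN iffD1], rule ext)

lemma norm_ell2_power2: "(norm (x :: ell2))\<^sup>2 = (\<Sum>k. (cmod (coord x k))\<^sup>2)"
proof -
  have "summable (\<lambda>k. cnj (coord x k) * coord x k)"
    by (intro summable_cnj_mult square_summable_coord)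
  then have "inner x x = (\<Sum>k. Re (cnj (coord x k) * coord x k))"
    unfolding inner_ell2_def cinner_ell2_def by (rule Re_suminf)
  moreover have "Re (cnj (coord x k) * coord x k) = (cmod (coord x k))\<^sup>2" for k
    unfolding cmod_power2 by (simp add: power2_eq_square)
  ultimately show ?thesis
    by (simp add: power2_norm_eq_inner)
qed

lemma norm_coord_le: "cmod (coord x k) \<le> norm x"
proof -
  have "(\<Sum>n\<in>{k}. (cmod (coord x n))\<^sup>2) \<le> (\<Sum>n. (cmod (coord x n))\<^sup>2)"
    using square_summable_coord[of x] unfolding square_summable_def
    by (intro sum_le_suminf) auto
  then show ?thesis
    using power2_le_imp_le[of "cmod (coord x k)" "norm x"] by (simp add: norm_ell2_power2)
qed

lemma norm_scale_ell2: "norm (scale_ell2 c x) = cmod c * norm x"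
proof -
  have "(norm (scale_ell2 c x))\<^sup>2 = (\<Sum>k. (cmod c)\<^sup>2 * (cmod (coord x k))\<^sup>2)"
    by (simp add: norm_ell2_power2 scale_ell2.rep_eq norm_mult power_mult_distrib)
  also have "\<dots> = (cmod c * norm x)\<^sup>2"
    using square_summable_coord[of x] unfolding square_summable_def
    by (simp add: norm_ell2_power2 suminf_mult power_mult_distrib)
  finally show ?thesis
    by (rule power2_eq_imp_eq) simp_all
qed

lemma tendsto_coord:
  assumes "X \<longlonglongrightarrow> x"
  shows "(\<lambda>n. coord (X n) k) \<longlonglongrightarrow> coord x k"
proof (rule Lim_null_comparison[THEN LIM_zero_cancel])
  show "\<forall>\<^sub>F n in sequentially. cmod (coord (X n) k - coord x k) \<le> norm (X n - x)"
    by (intro always_eventually allI) (metis coord_diff norm_coord_le)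
  show "(\<lambda>n. norm (X n - x)) \<longlonglongrightarrow> 0"
    using assms by (intro tendsto_norm_zero LIM_zero)
qed

lemma tendsto_scale_ell2:
  assumes "X \<longlonglongrightarrow> x"
  shows "(\<lambda>n. scale_ell2 c (X n)) \<longlonglongrightarrow> scale_ell2 c x"
proof (rule Lim_null_comparison[THEN LIM_zero_cancel])
  have "scale_ell2 c (X n) - scale_ell2 c x = scale_ell2 c (X n - x)" for n
    by (rule ell2.scale_right_diff_distrib[symmetric])
  then show "\<forall>\<^sub>F n in sequentially. norm (scale_ell2 c (X n) - scale_ell2 c x) \<le> cmod c * norm (X n - x)"
    by (simp add: norm_scale_ell2)
  show "(\<lambda>n. cmod c * norm (X n - x)) \<longlonglongrightarrow> 0"
    using assms by (intro tendsto_mult_right_zero tendsto_norm_zero LIM_zero)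
qed

lemma cinner_delta: "cinner_ell2 (delta k) x = coord x k"
proof -
  have "(\<Sum>n. cnj (coord (delta k) n) * coord x n) = (\<Sum>n\<in>{k}. cnj (coord (delta k) n) * coord x n)"
    by (rule suminf_finite) (auto simp: delta.rep_eq)
  then show ?thesis
    by (simp add: cinner_ell2_def delta.rep_eq)
qed

lemma coord_truncation:
  "coord (\<Sum>k<N. scale_ell2 (coord x k) (delta k)) n = (if n < N then coord x n else 0)"
  by (simp add: coord_sum scale_ell2.rep_eq delta.rep_eq if_distrib sum.delta' cong: if_cong)

lemma truncation_tendsto: "(\<lambda>N. \<Sum>k<N. scale_ell2 (coord x k) (delta k)) \<longlonglongrightarrow> x"
proof (rule LIM_zero_cancel, rule tendsto_norm_zero_cancel)
  define P where "P N = (\<Sum>k<N. scale_ell2 (coord x k) (delta k))" for N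
  define a where "a k = (cmod (coord x k))\<^sup>2" for k
  have sm: "summable a"
    using square_summable_coord[of x] unfolding square_summable_def a_def .
  have "(norm (P N - x))\<^sup>2 = suminf a - sum a {..<N}" for N
  proof -
    have "(norm (P N - x))\<^sup>2 = (\<Sum>k. a k - (if k < N then a k else 0))"
      by (auto simp: norm_ell2_power2 P_def coord_diff coord_truncation a_def intro!: suminf_cong)
    also have "\<dots> = suminf a - (\<Sum>k. if k < N then a k else 0)"
      by (intro suminf_diff[symmetric] sm summable_finite[of "{..<N}"]) auto
    also have "(\<Sum>k. if k < N then a k else 0) = (\<Sum>k<N. if k < N then a k else 0)"
      by (rule suminf_finite) auto
    finally show ?thesis by simp
  qed
  moreover have "(\<lambda>N. suminf a - sum a {..<N}) \<longlonglongrightarrow> suminf a - suminf a"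
    by (intro tendsto_intros summable_LIMSEQ sm)
  ultimately have "(\<lambda>N. (norm (P N - x))\<^sup>2) \<longlonglongrightarrow> 0"
    by simp
  then have "(\<lambda>N. sqrt ((norm (P N - x))\<^sup>2)) \<longlonglongrightarrow> sqrt 0"
    by (rule tendsto_real_sqrt)
  then show "(\<lambda>N. norm ((\<Sum>k<N. scale_ell2 (coord x k) (delta k)) - x)) \<longlonglongrightarrow> 0"
    by (simp add: P_def)
qed

lemma orthonormal_basis_delta: "orthonormal_basis delta"
proof -
  have "x \<in> closure (ell2.span (range delta))" for x
    unfolding closure_sequential
    by (rule exI[of _ "\<lambda>N. \<Sum>k<N. scale_ell2 (coord x k) (delta k)"])
      (auto intro!: truncation_tendsto ell2.span_sum ell2.span_scale intro: ell2.span_base)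
  then show ?thesis
    by (auto simp: orthonormal_basis_def cinner_delta delta.rep_eq)
qed

lemma op_apply_eq: "is_operator A \<Longrightarrow> (x, y) \<in> A \<Longrightarrow> op_apply A x = y"
  unfolding op_apply_def is_operator_def by (auto dest: single_valuedD)

lemma op_apply_graph: "is_operator A \<Longrightarrow> x \<in> Domain A \<Longrightarrow> (x, op_apply A x) \<in> A"
  using op_apply_eq by auto

lemma is_operator_sum:
  assumes "is_operator A" "\<And>k. k \<in> I \<Longrightarrow> (u k, y k) \<in> A"
  shows "(\<Sum>k\<in>I. scale_ell2 (c k) (u k), \<Sum>k\<in>I. scale_ell2 (c k) (y k)) \<in> A"
  using assms(2)
proof (induction I rule: infinite_finite_induct)
  case (insert i I)
  then have "(scale_ell2 (c i) (u i), scale_ell2 (c i) (y i)) \<in> A"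
    using assms(1) by (simp add: is_operator_def)
  moreover have "(\<Sum>k\<in>I. scale_ell2 (c k) (u k), \<Sum>k\<in>I. scale_ell2 (c k) (y k)) \<in> A"
    using insert by simp
  ultimately show ?case
    using assms(1) insert.hyps by (simp add: is_operator_def)
qed (use assms(1) in \<open>simp_all add: is_operator_def\<close>)

lemma jacobi_closure_row:
  assumes "(\<phi>, \<psi>) \<in> closure (jacobi_graph0 q b)"
  shows "coord \<psi> k = jacobi_row q b \<phi> k"
proof -
  obtain z where z: "\<And>n. z n \<in> jacobi_graph0 q b" "z \<longlonglongrightarrow> (\<phi>, \<psi>)"
    using closure_sequential[THEN iffD1, OF assms] by (elim exE conjE) auto
  have l1: "(\<lambda>n. fst (z n)) \<longlonglongrightarrow> \<phi>" and l2: "(\<lambda>n. snd (z n)) \<longlonglongrightarrow> \<psi>"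
    using tendsto_fst[OF z(2)] tendsto_snd[OF z(2)] by simp_all
  have "(\<lambda>n. jacobi_row q b (fst (z n)) k) \<longlonglongrightarrow> jacobi_row q b \<phi> k"
    unfolding jacobi_row_def by (cases "k = 0") (auto intro!: tendsto_intros tendsto_coord l1)
  moreover have "jacobi_row q b (fst (z n)) k = coord (snd (z n)) k" for n
    using z(1)[of n] unfolding jacobi_graph0_def by auto
  ultimately show ?thesis
    by (intro LIMSEQ_unique[OF tendsto_coord[OF l2]]) simp
qed

lemma closed_operator_jacobi: "closed_operator (closure (jacobi_graph0 q b))"
proof -
  let ?G = "jacobi_graph0 q b"
  have zero: "(0, 0) \<in> ?G"
    by (simp add: jacobi_graph0_def jacobi_row_def zero_ell2.rep_eq)
  have add: "(x + x', y + y') \<in> ?G" if "(x, y) \<in> ?G" "(x', y') \<in> ?G" for x y x' y'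
  proof -
    have "finite {k. coord (x + x') k \<noteq> 0}"
      by (rule finite_subset[of _ "{k. coord x k \<noteq> 0} \<union> {k. coord x' k \<noteq> 0}"])
        (use that in \<open>auto simp: jacobi_graph0_def plus_ell2.rep_eq\<close>)
    then show ?thesis
      using that by (simp add: jacobi_graph0_def jacobi_row_def plus_ell2.rep_eq algebra_simps)
  qed
  have scale: "(scale_ell2 c x, scale_ell2 c y) \<in> ?G" if "(x, y) \<in> ?G" for c x y
  proof -
    have "finite {k. coord (scale_ell2 c x) k \<noteq> 0}"
      by (rule finite_subset[of _ "{k. coord x k \<noteq> 0}"])
        (use that in \<open>auto simp: jacobi_graph0_def scale_ell2.rep_eq\<close>)
    then show ?thesis
      using that by (simp add: jacobi_graph0_def jacobi_row_def scale_ell2.rep_eq algebra_simps)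
  qed
  have "(x + x', y + y') \<in> closure ?G"
    if xy: "(x, y) \<in> closure ?G" "(x', y') \<in> closure ?G" for x y x' y'
  proof -
    obtain z z' where "\<And>n. z n \<in> ?G" "z \<longlonglongrightarrow> (x, y)" "\<And>n. z' n \<in> ?G" "z' \<longlonglongrightarrow> (x', y')"
      using xy unfolding closure_sequential by meson
    moreover from this have "z n + z' n \<in> ?G" for n
      using add[of "fst (z n)" "snd (z n)" "fst (z' n)" "snd (z' n)"] by (simp add: plus_prod_def)
    ultimately show ?thesis
      unfolding closure_sequential
      by (intro exI[of _ "\<lambda>n. z n + z' n"]) (use tendsto_add[of z "(x, y)" _ z' "(x', y')"] in auto)
  qed
  moreover have "(scale_ell2 c x, scale_ell2 c y) \<in> closure ?G"
    if xy: "(x, y) \<in> closure ?G" for c x y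
  proof -
    obtain z where z: "\<And>n. z n \<in> ?G" "z \<longlonglongrightarrow> (x, y)"
      using xy unfolding closure_sequential by meson
    have "(\<lambda>n. (scale_ell2 c (fst (z n)), scale_ell2 c (snd (z n)))) \<longlonglongrightarrow> (scale_ell2 c x, scale_ell2 c y)"
      using tendsto_fst[OF z(2)] tendsto_snd[OF z(2)]
      by (intro tendsto_Pair tendsto_scale_ell2) simp_all
    moreover have "(scale_ell2 c (fst (z n)), scale_ell2 c (snd (z n))) \<in> ?G" for n
      by (rule scale) (simp add: z(1))
    ultimately show ?thesis
      unfolding closure_sequential
      by (intro exI[of _ "\<lambda>n. (scale_ell2 c (fst (z n)), scale_ell2 c (snd (z n)))"]) simp
  qed
  moreover have "single_valued (closure ?G)"
    by (intro single_valuedI ell2_eqI) (simp add: jacobi_closure_row)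
  moreover have "(0, 0) \<in> closure ?G"
    using zero closure_subset[of ?G] by (rule rev_subsetD)
  ultimately show ?thesis
    unfolding closed_operator_def is_operator_def by (intro conjI closed_closure) blast+
qed

lemma jacobi_delta: "\<exists>\<psi>. (delta k, \<psi>) \<in> jacobi_graph0 q b"
proof -
  have "jacobi_row q b (delta k) n = 0" if "n \<notin> {..Suc k}" for n
    using that by (auto simp: jacobi_row_def delta.rep_eq)
  then have "square_summable (jacobi_row q b (delta k))"
    unfolding square_summable_def by (intro summable_finite[of "{..Suc k}"]) auto
  then have "coord (Abs_ell2 (jacobi_row q b (delta k))) = jacobi_row q b (delta k)"
    by (intro Abs_ell2_inverse) simp
  then have "(delta k, Abs_ell2 (jacobi_row q b (delta k))) \<in> jacobi_graph0 q b"
    unfolding jacobi_graph0_def by (simp add: delta.rep_eq)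
  then show ?thesis ..
qed

text \<open>The Jacobi operator is a closed operator represented by its Jacobi matrix.\<close>

lemma jacobi_operator_canonical:
  "basis_of_representation (closure (jacobi_graph0 q b)) delta"
  "matrix_representation (closure (jacobi_graph0 q b)) delta = tridiagonal q b"
proof -
  let ?G = "jacobi_graph0 q b"
  let ?J = "closure ?G"
  have op: "is_operator ?J"
    using closed_operator_jacobi by (simp add: closed_operator_def)
  have dom: "delta k \<in> Domain ?J" for k
    using jacobi_delta[of k q b] closure_subset[of ?G] by (elim exE) (rule DomainI, rule subsetD)
  have "?J \<subseteq> B" if B: "closed_operator B"
    and eq: "\<And>k. delta k \<in> Domain B \<and> op_apply B (delta k) = op_apply ?J (delta k)" for B
  proof (rule closure_minimal)
    show "closed B"
      using B by (simp add: closed_operator_def)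
    have opB: "is_operator B"
      using B by (simp add: closed_operator_def)
    show "?G \<subseteq> B"
    proof safe
      fix \<phi> \<psi> assume mem: "(\<phi>, \<psi>) \<in> ?G"
      define I where "I = {k. coord \<phi> k \<noteq> 0}"
      have fin: "finite I"
        using mem by (simp add: jacobi_graph0_def I_def)
      let ?\<psi> = "\<Sum>k\<in>I. scale_ell2 (coord \<phi> k) (op_apply ?J (delta k))"
      have \<phi>: "(\<Sum>k\<in>I. scale_ell2 (coord \<phi> k) (delta k)) = \<phi>"
        by (rule ell2_eqI)
          (use fin in \<open>auto simp: I_def coord_sum scale_ell2.rep_eq delta.rep_eq
             if_distrib sum.delta' cong: if_cong\<close>)
      have "(delta k, op_apply ?J (delta k)) \<in> B" for k
        using op_apply_graph[OF opB, of "delta k"] eq[of k] by simp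
      then have "(\<phi>, ?\<psi>) \<in> B"
        using is_operator_sum[OF opB, of I delta "\<lambda>k. op_apply ?J (delta k)" "coord \<phi>"] \<phi> by simp
      moreover have "(\<phi>, ?\<psi>) \<in> ?J"
        using is_operator_sum[OF op, of I delta "\<lambda>k. op_apply ?J (delta k)" "coord \<phi>"] \<phi>
          op_apply_graph[OF op dom] by simp
      then have "?\<psi> = \<psi>"
        using op mem closure_subset[of ?G] unfolding is_operator_def
        by (meson single_valuedD subsetD)
      ultimately show "(\<phi>, \<psi>) \<in> B"
        by simp
    qed
  qed
  then show "basis_of_representation ?J delta"
    unfolding basis_of_representation_def
    using closed_operator_jacobi orthonormal_basis_delta dom by blast
  show "matrix_representation ?J delta = tridiagonal q b"
  proof (intro ext)
    fix k j
    have "coord (op_apply ?J (delta j)) k = jacobi_row q b (delta j) k"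
      by (rule jacobi_closure_row) (rule op_apply_graph[OF op dom])
    then show "matrix_representation ?J delta k j = tridiagonal q b k j"
      by (auto simp: matrix_representation_def cinner_delta tridiagonal_def jacobi_row_def delta.rep_eq)
  qed
qed

lemma jacobi_operator_has_jacobi_basis:
  assumes "jacobi_operator J"
  shows "jacobi_basis J delta"
proof -
  obtain q b where "\<forall>k. 0 < b k" "J = closure (jacobi_graph0 q b)"
    using assms unfolding jacobi_operator_def by auto
  then show ?thesis
    unfolding jacobi_basis_def jacobi_matrix_def using jacobi_operator_canonical[of q b] by auto
qed

lemma cinner_scale:
  "cinner_ell2 (scale_ell2 c x) (scale_ell2 d y) = cnj c * d * cinner_ell2 x y"
proof -
  have "(\<Sum>k. cnj c * d * (cnj (coord x k) * coord y k))
      = cnj c * d * (\<Sum>k. cnj (coord x k) * coord y k)"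
    by (intro suminf_mult summable_cnj_mult square_summable_coord)
  then show ?thesis
    by (simp add: cinner_ell2_def scale_ell2.rep_eq mult_ac)
qed

lemma op_apply_scale:
  assumes "is_operator A" "x \<in> Domain A"
  shows "scale_ell2 c x \<in> Domain A" "op_apply A (scale_ell2 c x) = scale_ell2 c (op_apply A x)"
proof -
  have "(scale_ell2 c x, scale_ell2 c (op_apply A x)) \<in> A"
    using assms(1) op_apply_graph[OF assms] by (simp add: is_operator_def)
  then show "scale_ell2 c x \<in> Domain A" "op_apply A (scale_ell2 c x) = scale_ell2 c (op_apply A x)"
    using op_apply_eq[OF assms(1)] by auto
qed

text \<open>
  Multiplying all elements of a basis of representation by one unimodular number does not
  change the matrix. Hence, in the complex space, the factor \<open>-1\<close> alone does not describe
  the ambiguity of the basis.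
\<close>

lemma jacobi_basis_scale:
  assumes u: "jacobi_basis J u" and c: "cmod c = 1"
  shows "jacobi_basis J (\<lambda>k. scale_ell2 c (u k))"
    "matrix_representation J (\<lambda>k. scale_ell2 c (u k)) = matrix_representation J u"
proof -
  let ?v = "\<lambda>k. scale_ell2 c (u k)"
  have cc: "cnj c * c = 1"
    using c by (metis complex_norm_square mult.commute of_real_1 power_one)
  have br: "basis_of_representation J u"
    using u by (simp add: jacobi_basis_def)
  have opJ: "is_operator J" and dom: "\<And>k. u k \<in> Domain J"
    using br by (auto simp: basis_of_representation_def closed_operator_def)
  have u_eq: "u k = scale_ell2 (cnj c) (?v k)" for k
    using cc by simp
  have "u k \<in> ell2.span (range ?v)" for k
    by (subst u_eq) (intro ell2.span_scale ell2.span_base rangeI)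
  then have "ell2.span (range u) \<subseteq> ell2.span (range ?v)"
    by (intro ell2.span_minimal ell2.subspace_span) blast
  then have "closure (ell2.span (range u)) \<subseteq> closure (ell2.span (range ?v))"
    by (rule closure_mono)
  then have onb: "orthonormal_basis ?v"
    using br cc by (auto simp: basis_of_representation_def orthonormal_basis_def cinner_scale)
  have "J \<subseteq> B" if B: "closed_operator B"
    and eq: "\<And>k. ?v k \<in> Domain B \<and> op_apply B (?v k) = op_apply J (?v k)" for B
  proof -
    have opB: "is_operator B"
      using B by (simp add: closed_operator_def)
    have "u k \<in> Domain B \<and> op_apply B (u k) = op_apply J (u k)" for k
      using op_apply_scale[OF opB, of "?v k" "cnj c"] op_apply_scale[OF opJ, of "?v k" "cnj c"]
        op_apply_scale(1)[OF opJ dom, of c k] eq[of k] cc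
      by simp
    then show ?thesis
      using br B by (simp add: basis_of_representation_def)
  qed
  then have br': "basis_of_representation J ?v"
    using br onb op_apply_scale(1)[OF opJ dom] unfolding basis_of_representation_def by blast
  show mat: "matrix_representation J ?v = matrix_representation J u"
    using op_apply_scale(2)[OF opJ dom] cc by (simp add: matrix_representation_def cinner_scale)
  show "jacobi_basis J ?v"
    using u br' mat by (simp add: jacobi_basis_def)
qed

text \<open>
  The representing bases whose elements are real sequences are those for which a change of
  sign is the only possible unimodular factor.
\<close>

definition real_basis :: "(nat \<Rightarrow> ell2) \<Rightarrow> bool" where
  "real_basis u \<longleftrightarrow> (\<forall>k n. coord (u k) n \<in> \<real>)"

definition reflection :: "(nat \<Rightarrow> ell2) \<Rightarrow> nat \<Rightarrow> ell2" where
  "reflection u = (\<lambda>k. - u k)"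

end

theory Submission
  imports Defs "HOL-Complex_Analysis.Complex_Analysis"
begin

text \<open>
  If \<open>J\<close> is not self-adjoint, its orthogonal polynomials \<open>P\<^sub>n(z)\<close> form a square-summable
  sequence \<open>\<pi>(z)\<close> for every \<open>z\<close>. Variation of constants from \<open>\<i>\<close> to \<open>z\<close> bounds the norm of
  \<open>\<pi>(z)\<close> by an infinite product \<open>\<Prod>(1 + \<bar>z - \<i>\<bar> m\<^sub>k)\<close> with summable \<open>m\<close>, so \<open>\<pi>\<close> is of minimal
  exponential type. If \<open>v\<close> is another basis giving a Jacobi matrix, with polynomials \<open>P'\<^sub>k\<close>, then
  \<open>J\<^sup>* \<pi>(z) = z \<pi>(z)\<close> yields \<open>\<langle>v\<^sub>k, \<pi>(z)\<rangle> = P'\<^sub>k(z) g(z)\<close> with \<open>g(z) = \<langle>v\<^sub>0, \<pi>(z)\<rangle>\<close> entire,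
  without zeros (otherwise \<open>\<pi>(z) = 0\<close>) and of minimal exponential type, hence constant. As the
  \<open>\<pi>(z)\<close> are total, \<open>v\<^sub>0\<close> is a multiple of \<open>\<delta>\<^sub>0\<close>, and the three-term recurrence determines the rest.
\<close>

section \<open>Sesquilinear calculus, completeness and totality of orthonormal bases\<close>

section \<open>The Hilbert space of square-summable sequences\<close>

lemma Re_cinner: "Re (cinner_ell2 x y) = inner x y"
  by (simp add: inner_ell2_def)

lemma Im_cinner: "Im (cinner_ell2 x y) = inner (scale_ell2 \<i> x) y"
  using cinner_scale[of "\<i>" x 1 y] by (simp add: inner_ell2_def)

lemma cinner_commute: "cinner_ell2 y x = cnj (cinner_ell2 x y)"
proof -
  have "Im (cinner_ell2 y x) = inner x (scale_ell2 \<i> y)"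
    by (simp add: Im_cinner inner_commute)
  also have "\<dots> = - Im (cinner_ell2 x y)"
    using cinner_scale[of 1 x "\<i>" y] by (simp add: inner_ell2_def)
  finally show ?thesis
    by (simp add: complex_eq_iff Re_cinner inner_commute)
qed

lemma cinner_add_left: "cinner_ell2 (x + y) z = cinner_ell2 x z + cinner_ell2 y z"
  by (simp add: complex_eq_iff Re_cinner Im_cinner inner_add_left ell2.scale_right_distrib)

lemma cinner_add_right: "cinner_ell2 x (y + z) = cinner_ell2 x y + cinner_ell2 x z"
  by (simp add: complex_eq_iff Re_cinner Im_cinner inner_add_right)

lemma cinner_diff_left: "cinner_ell2 (x - y) z = cinner_ell2 x z - cinner_ell2 y z"
  by (simp add: complex_eq_iff Re_cinner Im_cinner inner_diff_left ell2.scale_right_diff_distrib)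

lemma cinner_diff_right: "cinner_ell2 x (y - z) = cinner_ell2 x y - cinner_ell2 x z"
  by (simp add: complex_eq_iff Re_cinner Im_cinner inner_diff_right)

lemma cinner_zero [simp]: "cinner_ell2 0 x = 0" "cinner_ell2 x 0 = 0"
  by (simp_all add: complex_eq_iff Re_cinner Im_cinner)

lemma cinner_scale_left: "cinner_ell2 (scale_ell2 c x) y = cnj c * cinner_ell2 x y"
  using cinner_scale[of c x 1 y] by simp

lemma cinner_scale_right: "cinner_ell2 x (scale_ell2 c y) = c * cinner_ell2 x y"
  using cinner_scale[of 1 x c y] by simp

lemma cinner_self: "cinner_ell2 x x = complex_of_real ((norm x)\<^sup>2)"
proof -
  have "Im (cinner_ell2 x x) = 0"
    using cinner_commute[of x x] by (simp add: complex_eq_iff)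
  then show ?thesis
    by (simp add: complex_eq_iff Re_cinner power2_norm_eq_inner)
qed

text \<open>The real inequality suffices: scaling the first argument by
  \<open>c = cinner_ell2 x y\<close> turns the real inner product into the square of
  \<open>cmod c\<close>.\<close>

lemma cinner_cauchy_schwarz: "cmod (cinner_ell2 x y) \<le> norm x * norm y"
proof (cases "cinner_ell2 x y = 0")
  case False
  define c where "c = cinner_ell2 x y"
  have "cmod c * cmod c = inner (scale_ell2 c x) y"
    by (simp add: inner_ell2_def cinner_scale_left c_def[symmetric] cmod_power2 flip: power2_eq_square)
  also have "\<dots> \<le> cmod c * (norm x * norm y)"
    using norm_cauchy_schwarz[of "scale_ell2 c x" y] by (simp add: norm_scale_ell2 mult.assoc)
  finally show ?thesis
    using False by (simp add: c_def)
qed simp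

lemma tendsto_cinner:
  assumes "X \<longlonglongrightarrow> x" "Y \<longlonglongrightarrow> y"
  shows "(\<lambda>n. cinner_ell2 (X n) (Y n)) \<longlonglongrightarrow> cinner_ell2 x y"
  unfolding tendsto_complex_iff Re_cinner Im_cinner
  using assms by (intro conjI tendsto_inner tendsto_scale_ell2)

lemma cinner_self_eq_1:
  assumes "cinner_ell2 x x = 1"
  shows "norm x = 1"
proof -
  have "(norm x)\<^sup>2 = 1\<^sup>2"
    using assms unfolding cinner_self by (metis of_real_eq_1_iff power_one)
  then show ?thesis
    by (rule power2_eq_imp_eq) simp_all
qed

lemma norm_delta: "norm (delta k) = 1"
  by (rule cinner_self_eq_1) (simp add: cinner_delta delta.rep_eq)

text \<open>Coordinatewise limits exist by completeness of the complex numbers. The Cauchy estimate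
  on finite sums of coordinates survives the limit and yields norm convergence.\<close>

lemma Cauchy_ell2_convergent:
  fixes X :: "nat \<Rightarrow> ell2"
  assumes X: "Cauchy X"
  shows "\<exists>l. X \<longlonglongrightarrow> l"
proof -
  have "Cauchy (\<lambda>n. coord (X n) k)" for k
  proof (rule CauchyI)
    fix e :: real assume "e > 0"
    then obtain M where M: "\<And>m n. m \<ge> M \<Longrightarrow> n \<ge> M \<Longrightarrow> norm (X m - X n) < e"
      using CauchyD[OF X] by blast
    show "\<exists>M. \<forall>m\<ge>M. \<forall>n\<ge>M. norm (coord (X m) k - coord (X n) k) < e"
      by (metis M coord_diff norm_coord_le order_le_less_trans)
  qed
  then obtain l where l: "\<And>k. (\<lambda>n. coord (X n) k) \<longlonglongrightarrow> l k"
    unfolding Cauchy_convergent_iff convergent_def by metis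
  \<comment> \<open>The limit in \<open>m\<close> is taken for each finite sum first, and only then
    is the number of terms released.\<close>
  have tail: "square_summable (\<lambda>k. coord (X n) k - l k) \<and> (\<Sum>k. (cmod (coord (X n) k - l k))\<^sup>2) \<le> e\<^sup>2"
    if e: "e > 0" "\<And>m. m \<ge> M \<Longrightarrow> norm (X n - X m) < e" for n e M
  proof -
    have le: "(\<Sum>k<N. (cmod (coord (X n) k - l k))\<^sup>2) \<le> e\<^sup>2" for N
    proof (rule LIMSEQ_le_const2)
      show "(\<lambda>m. \<Sum>k<N. (cmod (coord (X n) k - coord (X m) k))\<^sup>2)
          \<longlonglongrightarrow> (\<Sum>k<N. (cmod (coord (X n) k - l k))\<^sup>2)"
        by (intro tendsto_intros l)
      have "(\<Sum>k<N. (cmod (coord (X n) k - coord (X m) k))\<^sup>2) \<le> e\<^sup>2" if "m \<ge> M" for m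
      proof -
        have "(\<Sum>k<N. (cmod (coord (X n - X m) k))\<^sup>2) \<le> (norm (X n - X m))\<^sup>2"
          unfolding norm_ell2_power2 using square_summable_coord[of "X n - X m"]
          by (intro sum_le_suminf) (auto simp: square_summable_def)
        also have "\<dots> \<le> e\<^sup>2"
          using e(2)[OF that] by (intro power_mono) auto
        finally show ?thesis by (simp add: coord_diff)
      qed
      then show "\<exists>K. \<forall>m\<ge>K. (\<Sum>k<N. (cmod (coord (X n) k - coord (X m) k))\<^sup>2) \<le> e\<^sup>2"
        by blast
    qed
    have "summable (\<lambda>k. (cmod (coord (X n) k - l k))\<^sup>2)"
      using le by (intro summableI_nonneg_bounded) auto
    then show ?thesis
      using le by (auto simp: square_summable_def intro: suminf_le_const)
  qed
  obtain M where "\<And>m n. m \<ge> M \<Longrightarrow> n \<ge> M \<Longrightarrow> norm (X m - X n) < 1"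
    using CauchyD[OF X, of 1] by auto
  then have "square_summable (\<lambda>k. coord (X M) k - l k)"
    using tail[of 1 M M] by auto
  from square_summable_add[OF square_summable_coord[of "X M"] square_summable_scale[OF this, of "-1"]]
  have coord_l: "coord (Abs_ell2 l) = l"
    by (intro Abs_ell2_inverse) simp
  have "X \<longlonglongrightarrow> Abs_ell2 l"
  proof (rule LIMSEQ_I)
    fix e :: real assume "e > 0"
    then obtain M where M: "\<And>m n. m \<ge> M \<Longrightarrow> n \<ge> M \<Longrightarrow> norm (X m - X n) < e / 2"
      using CauchyD[OF X, of "e / 2"] by auto
    have "norm (X n - Abs_ell2 l) < e" if n: "n \<ge> M" for n
    proof -
      have "(norm (X n - Abs_ell2 l))\<^sup>2 \<le> (e / 2)\<^sup>2"
        using tail[of "e / 2" M n] M[OF n] \<open>e > 0\<close>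
        by (simp add: norm_ell2_power2 coord_diff coord_l)
      then have "norm (X n - Abs_ell2 l) \<le> e / 2"
        by (rule power2_le_imp_le) (use \<open>e > 0\<close> in auto)
      then show ?thesis using \<open>e > 0\<close> by linarith
    qed
    then show "\<exists>no. \<forall>n\<ge>no. norm (X n - Abs_ell2 l) < e" by blast
  qed
  then show ?thesis ..
qed

text \<open>Approximating \<open>x\<close> itself by elements of the span, all orthogonal to
  \<open>x\<close>, gives \<open>cinner_ell2 x x = 0\<close>.\<close>

lemma orthonormal_basis_orthogonal_imp_zero:
  assumes v: "orthonormal_basis v" and x: "\<And>k. cinner_ell2 (v k) x = 0"
  shows "x = 0"
proof -
  have "cinner_ell2 y x = 0" if "y \<in> ell2.span (range v)" for y
    using that x
    by (induction y rule: ell2.span_induct_alt) (auto simp: cinner_add_left cinner_scale_left)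
  moreover have "x \<in> closure (ell2.span (range v))"
    using v by (simp add: orthonormal_basis_def)
  then obtain y where y: "\<And>n. y n \<in> ell2.span (range v)" "y \<longlonglongrightarrow> x"
    unfolding closure_sequential by blast
  ultimately have "cinner_ell2 x x = 0"
    using tendsto_cinner[OF y(2) tendsto_const[of x]] by (simp add: LIMSEQ_const_iff)
  then show ?thesis
    by (simp add: cinner_self)
qed

section \<open>Product bounds and a Liouville theorem for zero-free functions\<close>

section \<open>Entire functions of minimal exponential type\<close>

text \<open>The tail of \<open>m\<close> contributes at most \<open>e / 2\<close> to the exponent.
  The finitely many other factors are damped by
  \<open>1 + t * m k \<le> 1 / d * (1 + t * (d * m k))\<close>, at the price of a constant
  independent of \<open>t\<close> and \<open>n\<close>.\<close>

lemma prod_one_plus_minimal_type: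
  fixes m :: "nat \<Rightarrow> real"
  assumes m: "summable m" "\<And>k. 0 \<le> m k" and e: "0 < e"
  shows "\<exists>C. \<forall>t\<ge>0. \<forall>n. (\<Prod>k<n. 1 + t * m k) \<le> C * exp (e * t)"
proof -
  have "(\<lambda>N. suminf m - sum m {..<N}) \<longlonglongrightarrow> suminf m - suminf m"
    by (intro tendsto_intros summable_LIMSEQ m)
  then have "\<forall>\<^sub>F N in sequentially. suminf m - sum m {..<N} < e / 2"
    using e by (intro order_tendstoD(2)) auto
  then obtain N where N: "suminf m - sum m {..<N} < e / 2"
    by (auto simp: eventually_sequentially)
  \<comment> \<open>Damping by \<open>d\<close> brings the head of the series to at most
    \<open>e / 2\<close>; the summand 1 in the denominator covers
    \<open>suminf m = 0\<close>.\<close>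
  define d where "d = min 1 (e / (2 * (suminf m + 1)))"
  have M0: "0 \<le> suminf m"
    using m by (intro suminf_nonneg) auto
  have d: "0 < d" "d \<le> 1" "d * suminf m \<le> e / 2"
  proof -
    show "0 < d" "d \<le> 1" using e M0 by (auto simp: d_def)
    have "d * suminf m \<le> e / (2 * (suminf m + 1)) * (suminf m + 1)"
      using M0 e by (intro mult_mono) (auto simp: d_def)
    also have "\<dots> = e / 2"
      using M0 by (simp add: field_simps)
    finally show "d * suminf m \<le> e / 2" .
  qed
  define g where "g k = (if k < N then d else 1) * m k" for k
  have g: "(\<Sum>k<n. g k) \<le> e" for n
  proof -
    have g0: "0 \<le> g k" for k using d m by (simp add: g_def)
    have "(\<Sum>k<n. g k) \<le> (\<Sum>k<n+N. g k)"
      using g0 by (intro sum_mono2) auto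
    also have "\<dots> = (\<Sum>k<N. g k) + (\<Sum>k=N..<n+N. g k)"
      using sum.atLeastLessThan_concat[of 0 N "n + N" g] by (simp add: atLeast0LessThan)
    also have "\<dots> = d * (\<Sum>k<N. m k) + ((\<Sum>k<n+N. m k) - (\<Sum>k<N. m k))"
      using sum.atLeastLessThan_concat[of 0 N "n + N" m]
      by (simp add: g_def sum_distrib_left atLeast0LessThan)
    also have "\<dots> \<le> d * suminf m + (suminf m - (\<Sum>k<N. m k))"
      using m d by (intro add_mono mult_left_mono diff_right_mono sum_le_suminf) auto
    finally show ?thesis using d N by linarith
  qed
  have factor: "1 + t * m k \<le> (if k < N then 1 / d else 1) * exp (t * g k)" if "t \<ge> 0" for t k
  proof (cases "k < N")
    case True
    have "1 + t * m k \<le> 1 / d * (1 + t * (d * m k))"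
      using d that m by (simp add: field_simps)
    also have "\<dots> \<le> 1 / d * exp (t * (d * m k))"
      using d by (intro mult_left_mono exp_ge_add_one_self) auto
    finally show ?thesis using True by (simp add: g_def)
  qed (simp add: g_def exp_ge_add_one_self)
  have D: "(\<Prod>k<n. if k < N then 1 / d else 1) \<le> (1 / d) ^ N" for n
  proof -
    have "(\<Prod>k<n. if k < N then 1 / d else 1) \<le> (\<Prod>k<n+N. if k < N then 1 / d else 1)"
      using d by (intro prod_mono2) auto
    also have "\<dots> = (\<Prod>k<N. 1 / d)"
      by (rule prod.mono_neutral_cong_right) auto
    finally show ?thesis by simp
  qed
  have "(\<Prod>k<n. 1 + t * m k) \<le> (1 / d) ^ N * exp (e * t)" if t: "t \<ge> 0" for t n
  proof -
    have "(\<Prod>k<n. 1 + t * m k) \<le> (\<Prod>k<n. (if k < N then 1 / d else 1) * exp (t * g k))"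
      using factor t m by (intro prod_mono) auto
    also have "\<dots> = (\<Prod>k<n. if k < N then 1 / d else 1) * exp (t * (\<Sum>k<n. g k))"
      by (simp add: prod.distrib exp_sum sum_distrib_left)
    also have "\<dots> \<le> (1 / d) ^ N * exp (t * e)"
      using D d g t by (intro mult_mono) (auto intro!: mult_left_mono prod_nonneg)
    finally show ?thesis by (simp add: mult.commute)
  qed
  then show ?thesis by blast
qed

text \<open>The induction runs on the right-hand side of the hypothesis: each step multiplies this
  majorant by at most \<open>1 + t * m n\<close>.\<close>

lemma discrete_gronwall:
  fixes u m :: "nat \<Rightarrow> real"
  assumes t: "0 \<le> t" "\<And>k. 0 \<le> m k"
    and u: "\<And>n. u n \<le> 1 + t * (\<Sum>k<n. m k * u k)"
  shows "u n \<le> (\<Prod>k<n. 1 + t * m k)"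
proof -
  have "1 + t * (\<Sum>k<n. m k * u k) \<le> (\<Prod>k<n. 1 + t * m k)"
  proof (induction n)
    case (Suc n)
    have "1 + t * (\<Sum>k<Suc n. m k * u k) = 1 + t * (\<Sum>k<n. m k * u k) + t * m n * u n"
      by (simp add: algebra_simps)
    also have "\<dots> \<le> 1 + t * (\<Sum>k<n. m k * u k) + t * m n * (1 + t * (\<Sum>k<n. m k * u k))"
      using t u by (intro add_left_mono mult_left_mono) auto
    also have "\<dots> = (1 + t * (\<Sum>k<n. m k * u k)) * (1 + t * m n)"
      by (simp add: algebra_simps)
    also have "\<dots> \<le> (\<Prod>k<n. 1 + t * m k) * (1 + t * m n)"
      using t by (intro mult_right_mono Suc.IH) auto
    finally show ?case by simp
  qed simp
  then show ?thesis using u[of n] by linarith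
qed

text \<open>With \<open>f = exp g\<close>, minimal type bounds \<open>Re g\<close> by a constant
  plus \<open>e * cmod z\<close> for every positive \<open>e\<close>. A Borel-Caratheodory estimate
  on large discs then bounds the derivative of \<open>g\<close> by \<open>4 * e\<close>, so it
  vanishes.\<close>

lemma zero_free_minimal_type_imp_constant:
  assumes f: "f holomorphic_on UNIV" "\<And>z. f z \<noteq> 0"
    and growth: "\<And>e. 0 < e \<Longrightarrow> \<exists>C. \<forall>z. cmod (f z) \<le> C * exp (e * cmod z)"
  shows "f z = f 0"
proof -
  obtain g where g: "g holomorphic_on UNIV" "\<And>z. f z = exp (g z)"
    using contractible_imp_holomorphic_log[of f UNIV] f by auto
  have "deriv g a = 0" for a
  proof -
    define h where "h = (\<lambda>\<zeta>. g (a + \<zeta>) - g a)"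
    have hol_h: "h holomorphic_on S" for S
      unfolding h_def
      by (intro holomorphic_intros holomorphic_on_compose_gen[OF _ g(1), unfolded o_def]) auto
    have "(g has_field_derivative deriv g a) (at (a + 0))"
      using holomorphic_derivI[OF g(1), of a] by simp
    then have "((\<lambda>\<zeta>. g (a + \<zeta>)) has_field_derivative deriv g a * 1) (at 0)"
      by (rule DERIV_chain2) (auto intro!: derivative_eq_intros)
    then have dh: "(h has_field_derivative deriv g a) (at 0)"
      unfolding h_def by (auto intro!: derivative_eq_intros)
    have bound: "cmod (deriv g a) \<le> 4 * e" if e: "0 < e" for e
    proof -
      obtain C where C: "\<And>z. cmod (f z) \<le> C * exp (e * cmod z)"
        using growth[OF e] by blast
      have C0: "C > 0"
        using C[of 0] f(2)[of 0] zero_less_norm_iff[of "f 0"] by (simp del: zero_less_norm_iff)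
      have "Re (g z) \<le> ln C + e * cmod z" for z
      proof -
        have "exp (Re (g z)) \<le> exp (ln C + e * cmod z)"
          using C[of z] g(2)[of z] C0 by (simp add: exp_add)
        then show ?thesis by simp
      qed
      then have Re_h: "Re (h \<zeta>) \<le> \<bar>ln C - Re (g a)\<bar> + e * cmod a + e * cmod \<zeta>" for \<zeta>
        using norm_triangle_ineq[of a \<zeta>] e mult_left_mono[of "cmod (a + \<zeta>)" "cmod a + cmod \<zeta>" e]
        by (auto simp: h_def distrib_left intro: order_trans[of _ "ln C + e * cmod (a + \<zeta>) - Re (g a)"])
      define K where "K = \<bar>ln C - Re (g a)\<bar> + e * cmod a"
      have K0: "K \<ge> 0" using e by (simp add: K_def)
      \<comment> \<open>The radius absorbs the constant \<open>K\<close>: on the disc of radius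
        \<open>r\<close> the real part of \<open>h\<close> is at most \<open>K + e * r\<close>,
        which is below \<open>2 * e * r = A\<close>.\<close>
      define r where "r = (K + 1) / e"
      have r: "r > 0" "K + 1 = e * r" using e K0 by (auto simp: r_def)
      define A where "A = 2 * e * r"
      have A0: "A > 0" using r e by (simp add: A_def)
      have hA: "Re (h (r * \<zeta>)) < A" if "cmod \<zeta> < 1" for \<zeta> :: complex
      proof -
        have "e * cmod (r * \<zeta>) \<le> e * r"
          using that e r by (simp add: norm_mult)
        then show ?thesis
          using Re_h[of "r * \<zeta>"] r K0 unfolding A_def K_def[symmetric] by linarith
      qed
      \<comment> \<open>The map sending \<open>w\<close> to \<open>w / (2 * A - w)\<close> takes the
        half-plane \<open>Re w < A\<close> into the unit disc and fixes 0, so the Schwarz lemma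
        applies. The derivative of \<open>\<phi>\<close> at 0 is
        \<open>r * deriv g a / (2 * A)\<close>.\<close>
      define \<phi> where "\<phi> = (\<lambda>\<zeta>::complex. h (r * \<zeta>) / (2 * A - h (r * \<zeta>)))"
      have nz: "2 * A - h (r * \<zeta>) \<noteq> 0" if "cmod \<zeta> < 1" for \<zeta> :: complex
        using hA[OF that] A0 by (auto simp: complex_eq_iff)
      have h0: "h 0 = 0" by (simp add: h_def)
      have hol_hr: "(\<lambda>\<zeta>. h (r * \<zeta>)) holomorphic_on S" for S
        by (intro holomorphic_on_compose_gen[OF _ hol_h[of UNIV], unfolded o_def] holomorphic_intros) auto
      have "cmod (deriv \<phi> 0) \<le> 1"
      proof (rule Schwarz_Lemma(2))
        show "\<phi> holomorphic_on ball 0 1"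
          unfolding \<phi>_def using nz by (intro holomorphic_intros hol_hr) auto
        show "\<phi> 0 = 0" by (simp add: \<phi>_def h0)
        show "cmod (0::complex) < 1" by simp
        fix z :: complex assume z: "cmod z < 1"
        let ?w = "h (r * z)"
        have "(cmod (2 * A - ?w))\<^sup>2 - (cmod ?w)\<^sup>2 = 4 * A * (A - Re ?w)"
          unfolding cmod_power2 by (simp add: power2_eq_square algebra_simps)
        also have "\<dots> > 0" using hA[OF z] A0 by simp
        finally have "cmod ?w < cmod (2 * A - ?w)"
          by (intro power2_less_imp_less[of "cmod ?w"]) auto
        then show "cmod (\<phi> z) < 1"
          using nz[OF z] by (simp add: \<phi>_def norm_divide divide_less_eq)
      qed
      moreover have "(\<phi> has_field_derivative (r * deriv g a) / (2 * A)) (at 0)"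
      proof -
        have "(h has_field_derivative deriv g a) (at (complex_of_real r * 0))"
          using dh by simp
        then have hr: "((\<lambda>\<zeta>. h (r * \<zeta>)) has_field_derivative deriv g a * r) (at 0)"
          by (rule DERIV_chain2) (auto intro!: derivative_eq_intros)
        have "((\<lambda>\<zeta>. 2 * A - h (r * \<zeta>)) has_field_derivative 0 - deriv g a * r) (at 0)"
          by (intro DERIV_diff DERIV_const hr)
        from DERIV_divide[OF hr this] show ?thesis
          unfolding \<phi>_def using A0 by (simp add: h0 mult.commute)
      qed
      then have "deriv \<phi> 0 = (r * deriv g a) / (2 * A)"
        by (rule DERIV_imp_deriv)
      ultimately have "r * cmod (deriv g a) \<le> 2 * A"
        using A0 r by (simp add: norm_mult norm_divide divide_le_eq)
      then show ?thesis
        using r unfolding A_def by (simp add: mult.commute mult.left_commute)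
    qed
    have "cmod (deriv g a) \<le> 0"
    proof (rule field_le_epsilon)
      fix e :: real assume "0 < e"
      then show "cmod (deriv g a) \<le> 0 + e" using bound[of "e / 4"] by simp
    qed
    then show ?thesis by simp
  qed
  then have "(g has_field_derivative 0) (at x)" for x
    using holomorphic_derivI[OF g(1), of x] by simp
  then have "g constant_on UNIV"
    by (intro has_field_derivative_0_imp_constant_on) auto
  then have "g z = g 0"
    by (auto simp: constant_on_def)
  then show ?thesis by (simp add: g(2))
qed

section \<open>Orthogonal polynomials and the triangular Green function\<close>

section \<open>Three-term recurrences\<close>

text \<open>The recurrence on bare sequences, so that it applies to polynomial values not known to
  be square summable.\<close>

definition trow :: "(nat \<Rightarrow> real) \<Rightarrow> (nat \<Rightarrow> real) \<Rightarrow> (nat \<Rightarrow> complex) \<Rightarrow> nat \<Rightarrow> complex" where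
  "trow q b s k =
     (if k = 0 then 0 else complex_of_real (b (k - 1)) * s (k - 1)) +
     complex_of_real (q k) * s k + complex_of_real (b k) * s (Suc k)"

lemma jacobi_row_eq_trow: "jacobi_row q b \<phi> = trow q b (coord \<phi>)"
  by (simp add: fun_eq_iff jacobi_row_def trow_def)

lemma trow_zero: "trow q b (\<lambda>n. 0) k = 0"
  by (simp add: trow_def)

lemma trow_add: "trow q b (\<lambda>n. x n + y n) k = trow q b x k + trow q b y k"
  by (simp add: trow_def algebra_simps)

lemma trow_diff: "trow q b (\<lambda>n. x n - y n) k = trow q b x k - trow q b y k"
  by (simp add: trow_def algebra_simps)

lemma trow_scale: "trow q b (\<lambda>n. c * x n) k = c * trow q b x k"
  by (simp add: trow_def algebra_simps)

lemma trow_sum: "trow q b (\<lambda>n. \<Sum>i\<in>I. x i n) k = (\<Sum>i\<in>I. trow q b (x i) k)"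
  by (induction I rule: infinite_finite_induct) (simp_all add: trow_zero trow_add)

lemma trow_cnj: "trow q b (\<lambda>n. cnj (x n)) k = cnj (trow q b x k)"
  by (simp add: trow_def)

lemma trow_tendsto:
  assumes "\<And>k. (\<lambda>n. X n k) \<longlonglongrightarrow> x k"
  shows "(\<lambda>n. trow q b (X n) k) \<longlonglongrightarrow> trow q b x k"
  unfolding trow_def by (cases "k = 0") (auto intro!: tendsto_intros assms)

text \<open>The discrete Green identity: by symmetry of the matrix the sum telescopes to a boundary
  Wronskian. The pairing is bilinear, without conjugation.\<close>

lemma trow_green:
  "(\<Sum>n<Suc N. x n * trow q b u n - trow q b x n * u n)
     = b N * (x N * u (Suc N) - x (Suc N) * u N)"
  by (induction N) (simp_all add: trow_def algebra_simps)

lemma trow_green_finite: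
  assumes "\<And>n. n \<ge> N \<Longrightarrow> u n = 0"
  shows "(\<Sum>n<Suc N. x n * trow q b u n) = (\<Sum>n<Suc N. trow q b x n * u n)"
  using trow_green[of x q b u N] assms by (simp add: sum_subtractf)

text \<open>Forward solution of \<open>trow q b s k = z * s k + f k\<close> with
  \<open>s 0 = c\<close>, each row being solved for its last entry.\<close>

fun tri_sol :: "(nat \<Rightarrow> real) \<Rightarrow> (nat \<Rightarrow> real) \<Rightarrow> complex \<Rightarrow> complex \<Rightarrow> (nat \<Rightarrow> complex) \<Rightarrow> nat \<Rightarrow> complex"
where
  "tri_sol q b z c f 0 = c"
| "tri_sol q b z c f (Suc 0) = ((z - q 0) * c + f 0) / b 0"
| "tri_sol q b z c f (Suc (Suc n)) =
     ((z - q (Suc n)) * tri_sol q b z c f (Suc n) - b n * tri_sol q b z c f n + f (Suc n)) / b (Suc n)"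

lemma holomorphic_tri_sol: "(\<lambda>z. tri_sol q b z c f n) holomorphic_on S"
  by (induction n rule: induct_nat_012) (auto simp: divide_inverse intro!: holomorphic_intros)

definition opoly :: "(nat \<Rightarrow> real) \<Rightarrow> (nat \<Rightarrow> real) \<Rightarrow> complex \<Rightarrow> nat \<Rightarrow> complex" where
  "opoly q b z = tri_sol q b z 1 (\<lambda>n. 0)"

text \<open>The causal fundamental solution for a unit source in row \<open>m\<close>; for
  \<open>m = 0\<close> these are the polynomials of the second kind.\<close>

definition green_fun :: "(nat \<Rightarrow> real) \<Rightarrow> (nat \<Rightarrow> real) \<Rightarrow> complex \<Rightarrow> nat \<Rightarrow> nat \<Rightarrow> complex" where
  "green_fun q b z m = tri_sol q b z 0 (\<lambda>n. if n = m then 1 else 0)"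

lemma opoly_0 [simp]: "opoly q b z 0 = 1"
  by (simp add: opoly_def)

lemma green_fun_0 [simp]: "green_fun q b z m 0 = 0"
  by (simp add: green_fun_def)

locale jacobi_parameters =
  fixes q b :: "nat \<Rightarrow> real"
  assumes b_pos: "0 < b k"
begin

lemma b_nz [simp]: "b k \<noteq> 0"
  using b_pos[of k] by simp

lemma trow_tri_sol: "trow q b (tri_sol q b z c f) k = z * tri_sol q b z c f k + f k"
  by (cases k) (simp_all add: trow_def field_simps)

text \<open>Since no \<open>b k\<close> vanishes, each row determines the next entry. Identities
  between sequences are proved by this: equal source and equal start suffice.\<close>

lemma tri_sol_unique:
  assumes "\<And>k. trow q b s k = z * s k + f k"
  shows "s n = tri_sol q b z (s 0) f n"
proof (induction n rule: induct_nat_012)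
  case 1
  have "b 0 * s 1 = (z - q 0) * s 0 + f 0"
    using assms[of 0] by (simp add: trow_def algebra_simps)
  then show ?case by (simp add: field_simps)
next
  case (ge2 n)
  have "b (Suc n) * s (Suc (Suc n)) = (z - q (Suc n)) * s (Suc n) - b n * s n + f (Suc n)"
    using assms[of "Suc n"] by (simp add: trow_def algebra_simps)
  then have "s (Suc (Suc n)) = ((z - q (Suc n)) * s (Suc n) - b n * s n + f (Suc n)) / b (Suc n)"
    by (simp add: field_simps)
  then show ?case using ge2 by simp
qed simp

lemma trow_opoly: "trow q b (opoly q b z) k = z * opoly q b z k"
  by (simp add: opoly_def trow_tri_sol)

lemma trow_green_fun:
  "trow q b (green_fun q b z m) k = z * green_fun q b z m k + (if k = m then 1 else 0)"
  by (simp add: green_fun_def trow_tri_sol)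

lemma eigenvector_eq_opoly:
  assumes "\<And>k. trow q b s k = z * s k"
  shows "s n = s 0 * opoly q b z n"
proof -
  have "s n = tri_sol q b z (s 0) (\<lambda>n. 0) n"
    using assms by (intro tri_sol_unique) simp
  moreover have "s 0 * opoly q b z n = tri_sol q b z (s 0 * opoly q b z 0) (\<lambda>n. 0) n"
    by (rule tri_sol_unique[of "\<lambda>n. s 0 * opoly q b z n"]) (simp add: trow_scale trow_opoly)
  ultimately show ?thesis by simp
qed

text \<open>In Green's identity for both kinds of polynomials the eigenvalue terms cancel; the only
  source sits in row 0, where the first kind equals 1.\<close>

lemma wronskian:
  "b n * (opoly q b z n * green_fun q b z 0 (Suc n) - opoly q b z (Suc n) * green_fun q b z 0 n) = 1"
proof -
  let ?P = "opoly q b z" and ?Q = "green_fun q b z 0"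
  have "(\<Sum>k<Suc n. ?P k * trow q b ?Q k - trow q b ?P k * ?Q k)
      = (\<Sum>k<Suc n. if k = 0 then 1 else 0)"
    by (intro sum.cong) (auto simp: trow_green_fun trow_opoly algebra_simps)
  then show ?thesis
    unfolding trow_green by simp
qed

text \<open>Variation of constants: the combination \<open>v\<close> of both kinds vanishes at
  \<open>m\<close>. Cutting it off there creates a source in row \<open>m\<close>, which the
  Wronskian normalises to 1.\<close>

lemma green_fun_eq:
  "green_fun q b z m k =
     (if k \<le> m then 0
      else opoly q b z m * green_fun q b z 0 k - green_fun q b z 0 m * opoly q b z k)"
proof -
  let ?P = "opoly q b z" and ?Q = "green_fun q b z 0"
  define v where "v k = ?P m * ?Q k - ?Q m * ?P k" for k
  define s where "s k = (if k \<le> m then 0 else v k)" for k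
  have vm: "v m = 0" by (simp add: v_def)
  have tv: "trow q b v k = z * v k + ?P m * (if k = 0 then 1 else 0)" for k
    unfolding v_def
    by (simp only: trow_diff trow_scale trow_green_fun trow_opoly) (simp add: algebra_simps)
  have "trow q b s k = z * s k + (if k = m then 1 else 0)" for k
  proof -
    consider "k < m" | "k = m" | "k > m" by linarith
    then show ?thesis
    proof cases
      case 1
      then show ?thesis by (auto simp: trow_def s_def)
    next
      case 2
      have "trow q b s m = b m * v (Suc m)"
        by (simp add: trow_def s_def)
      also have "\<dots> = 1"
        using wronskian[of m z] by (simp add: v_def algebra_simps)
      finally show ?thesis using 2 by (simp add: s_def)
    next
      case 3
      \<comment> \<open>For \<open>k = m + 1\<close> the row reaches back to index \<open>m\<close>,
        where \<open>v\<close> vanishes, so the cut-off does not alter it.\<close>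
      then have "trow q b s k = trow q b v k"
        using vm by (auto simp: trow_def s_def) (metis One_nat_def Suc_leI Suc_pred le_antisym less_Suc_eq_le gr_implies_not0 not_gr_zero)
      then show ?thesis using 3 by (simp add: tv s_def)
    qed
  qed
  then have "s k = tri_sol q b z (s 0) (\<lambda>n. if n = m then 1 else 0) k"
    by (rule tri_sol_unique)
  then have "green_fun q b z m k = s k"
    unfolding green_fun_def by (simp add: s_def)
  then show ?thesis
    by (simp add: s_def v_def)
qed

lemma green_fun_eq_0: "k \<le> m \<Longrightarrow> green_fun q b z m k = 0"
  by (subst green_fun_eq) simp

text \<open>
  \<open>green_fun q b z m k\<close> is the coefficient of \<open>P\<^sub>m(t)\<close> in the polynomial
  \<open>(P\<^sub>k(t) - P\<^sub>k(z)) / (t - z)\<close>. Multiplication by \<open>t\<close> acts on coefficients as \<open>trow\<close>, which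
  explains the identity in the index \<open>m\<close>.
\<close>

lemma trow_green_fun_column:
  "trow q b (\<lambda>m. green_fun q b z m k) m =
     z * green_fun q b z m k + (if m = k then 1 else 0) - (if m = 0 then opoly q b z k else 0)"
proof -
  \<comment> \<open>With \<open>m\<close> fixed, both sides are read as sequences in
    \<open>k\<close>. Rows in \<open>m\<close> and in \<open>k\<close> commute, so both solve the
    same inhomogeneous recurrence, and both start at 0.\<close>
  define T where "T k = trow q b (\<lambda>m. green_fun q b z m k) m" for k
  define f where "f k = trow q b (\<lambda>m. if k = m then 1 else 0) m" for k
  have "trow q b T k = trow q b (\<lambda>m. trow q b (green_fun q b z m) k) m" for k
    unfolding T_def by (simp add: trow_def algebra_simps)
  then have T: "trow q b T k = z * T k + f k" for k
    by (simp add: trow_green_fun trow_add trow_scale T_def f_def)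
  define S where "S k = z * green_fun q b z m k + (if m = k then 1 else 0)
    - (if m = 0 then 1 else 0) * opoly q b z k" for k
  have "trow q b S k = z * (z * green_fun q b z m k + (if k = m then 1 else 0))
      + trow q b (\<lambda>k. if m = k then 1 else 0) k - (if m = 0 then 1 else 0) * (z * opoly q b z k)" for k
    unfolding S_def by (simp only: trow_add trow_diff trow_scale trow_green_fun trow_opoly)
  moreover have "trow q b (\<lambda>k. if m = k then 1 else 0) k = f k" for k
    by (auto simp: trow_def f_def)
  ultimately have S: "trow q b S k = z * S k + f k" for k
    by (simp add: S_def algebra_simps)
  have "T 0 = 0" by (simp add: T_def trow_zero)
  moreover have "S 0 = 0" by (simp add: S_def)
  ultimately have "T k = S k"
    using tri_sol_unique[of T z f k, OF T] tri_sol_unique[of S z f k, OF S] by simp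
  then show ?thesis by (simp add: T_def S_def)
qed

text \<open>Variation of constants from \<open>w\<close> to \<open>z\<close>: the column identity at
  \<open>w\<close> is paired with \<open>opoly q b z\<close>, and Green's identity moves the matrix
  onto this eigenvector.\<close>

lemma opoly_shift:
  "opoly q b z n = opoly q b w n + (z - w) * (\<Sum>k<n. green_fun q b w k n * opoly q b z k)"
proof -
  let ?P = "opoly q b z" and ?c = "\<lambda>m. green_fun q b w m n"
  \<comment> \<open>The column vanishes from index \<open>n\<close> on, which removes the boundary
    term; row \<open>n\<close> is kept because the unit source lies there.\<close>
  have "(\<Sum>m<Suc n. ?P m * trow q b ?c m) = (\<Sum>m<Suc n. trow q b ?P m * ?c m)"
    by (rule trow_green_finite) (simp add: green_fun_eq_0)
  also have "\<dots> = z * (\<Sum>m<Suc n. ?c m * ?P m)"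
    by (simp add: trow_opoly sum_distrib_left algebra_simps)
  also have "(\<Sum>m<Suc n. ?P m * trow q b ?c m)
      = (\<Sum>m<Suc n. w * (?c m * ?P m) + (if m = n then ?P n else 0) - (if m = 0 then opoly q b w n else 0))"
    by (intro sum.cong) (auto simp: trow_green_fun_column algebra_simps)
  also have "\<dots> = w * (\<Sum>m<Suc n. ?c m * ?P m) + ?P n - opoly q b w n"
    by (simp only: sum_subtractf sum.distrib sum_distrib_left) simp
  finally have "?P n = opoly q b w n + (z - w) * (\<Sum>m<Suc n. ?c m * ?P m)"
    by (simp add: algebra_simps)
  also have "(\<Sum>m<Suc n. ?c m * ?P m) = (\<Sum>m<n. ?c m * ?P m)"
    by (simp add: green_fun_eq_0)
  finally show ?thesis .
qed

end

section \<open>The adjoint, truncated resolvents and self-adjointness\<close>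

section \<open>The limit point case\<close>

definition finvec :: "nat \<Rightarrow> (nat \<Rightarrow> complex) \<Rightarrow> ell2" where
  "finvec N x = (\<Sum>k<N. scale_ell2 (x k) (delta k))"

lemma coord_finvec: "coord (finvec N x) n = (if n < N then x n else 0)"
  by (simp add: finvec_def coord_sum scale_ell2.rep_eq delta.rep_eq if_distrib sum.delta' cong: if_cong)

lemma cinner_finvec: "cinner_ell2 (finvec N x) y = (\<Sum>k<N. cnj (x k) * coord y k)"
proof -
  have "(\<Sum>k. cnj (coord (finvec N x) k) * coord y k) = (\<Sum>k<N. cnj (coord (finvec N x) k) * coord y k)"
    by (rule suminf_finite) (auto simp: coord_finvec)
  then show ?thesis
    by (simp add: cinner_ell2_def coord_finvec)
qed

lemma norm_finvec_power2: "(norm (finvec N x))\<^sup>2 = (\<Sum>k<N. (cmod (x k))\<^sup>2)"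
proof -
  have "(\<Sum>k. (cmod (coord (finvec N x) k))\<^sup>2) = (\<Sum>k<N. (cmod (coord (finvec N x) k))\<^sup>2)"
    by (rule suminf_finite) (auto simp: coord_finvec)
  then show ?thesis
    by (simp add: norm_ell2_power2 coord_finvec)
qed

lemma norm_finvec_coord_le: "norm (finvec N (coord x)) \<le> norm x"
proof (rule power2_le_imp_le)
  show "(norm (finvec N (coord x)))\<^sup>2 \<le> (norm x)\<^sup>2"
    unfolding norm_finvec_power2 norm_ell2_power2[of x]
    using square_summable_coord[of x] by (intro sum_le_suminf) (auto simp: square_summable_def)
qed simp

lemma coord_diff_fun: "coord (x - y) = (\<lambda>k. coord x k - coord y k)"
  by (simp add: fun_eq_iff coord_diff)

lemma finvec_coord_tendsto: "(\<lambda>N. finvec N (coord x)) \<longlonglongrightarrow> x"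
  unfolding finvec_def by (rule truncation_tendsto)

lemma cauchy_schwarz_sum:
  "cmod (\<Sum>k<N. cnj (x k) * y k) \<le> norm (finvec N x) * norm (finvec N y)"
  using cinner_cauchy_schwarz[of "finvec N x" "finvec N y"] by (simp add: cinner_finvec coord_finvec)

context jacobi_parameters
begin

lemma graph0_cinner:
  assumes uv: "(u, v) \<in> jacobi_graph0 q b" and xy: "\<And>k. coord y k = trow q b (coord x) k"
  shows "cinner_ell2 x v = cinner_ell2 y u"
proof -
  obtain N where "{k. coord u k \<noteq> 0} \<subseteq> {..<N}"
    using uv finite_nat_iff_bounded[of "{k. coord u k \<noteq> 0}"] by (auto simp: jacobi_graph0_def)
  then have u: "coord u n = 0" if "n \<ge> N" for n
    using that by (force simp: not_less[symmetric])
  have v: "coord v n = trow q b (coord u) n" for n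
    using uv by (simp add: jacobi_graph0_def jacobi_row_eq_trow)
  have v0: "coord v n = 0" if "n \<notin> {..<Suc N}" for n
    using that u by (auto simp: v trow_def)
  have "cinner_ell2 x v = (\<Sum>n<Suc N. cnj (coord x n) * coord v n)"
    unfolding cinner_ell2_def using v0 by (intro suminf_finite) auto
  also have "\<dots> = (\<Sum>n<Suc N. cnj (coord y n) * coord u n)"
    using trow_green_finite[of N "coord u" "\<lambda>n. cnj (coord x n)" q b] u
    by (simp only: v xy trow_cnj)
  also have "\<dots> = cinner_ell2 y u"
    unfolding cinner_ell2_def using u by (intro suminf_finite[symmetric]) auto
  finally show ?thesis .
qed

text \<open>Symmetry makes \<open>cinner_ell2 u v\<close> real, so pairing \<open>u\<close> with
  \<open>v - scale_ell2 z u\<close> has imaginary part \<open>- Im z\<close> times the squared norm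
  of \<open>u\<close>.\<close>

lemma graph0_bound:
  assumes uv: "(u, v) \<in> jacobi_graph0 q b"
  shows "\<bar>Im z\<bar> * norm u \<le> norm (v - scale_ell2 z u)"
proof (cases "u = 0")
  case False
  have "cinner_ell2 u v = cinner_ell2 v u"
    using uv by (intro graph0_cinner) (auto simp: jacobi_graph0_def jacobi_row_eq_trow)
  then have "Im (cinner_ell2 u v) = 0"
    using cinner_commute[of u v] by (metis Reals_cnj_iff complex_is_Real_iff)
  then have "Im (cinner_ell2 u (v - scale_ell2 z u)) = - (Im z * (norm u)\<^sup>2)"
    by (simp add: cinner_diff_right cinner_scale_right cinner_self)
  then have "\<bar>Im z\<bar> * (norm u)\<^sup>2 \<le> cmod (cinner_ell2 u (v - scale_ell2 z u))"
    using abs_Im_le_cmod[of "cinner_ell2 u (v - scale_ell2 z u)"] by (simp add: abs_mult)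
  also have "\<dots> \<le> norm u * norm (v - scale_ell2 z u)"
    by (rule cinner_cauchy_schwarz)
  finally show ?thesis
    using False by (simp add: power2_eq_square mult.left_commute)
qed simp

lemma graph0_diff:
  assumes "(u, v) \<in> jacobi_graph0 q b" "(u', v') \<in> jacobi_graph0 q b"
  shows "(u - u', v - v') \<in> jacobi_graph0 q b"
proof -
  have "finite {k. coord (u - u') k \<noteq> 0}"
    by (rule finite_subset[of _ "{k. coord u k \<noteq> 0} \<union> {k. coord u' k \<noteq> 0}"])
      (use assms in \<open>auto simp: jacobi_graph0_def coord_diff\<close>)
  then show ?thesis
    using assms by (simp add: jacobi_graph0_def jacobi_row_eq_trow coord_diff_fun trow_diff)
qed

text \<open>The adjoint is the maximal operator: testing against \<open>delta k\<close> reads off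
  row \<open>k\<close>, and conversely \<open>graph0_cinner\<close> passes to the closure by
  continuity.\<close>

lemma adjoint_jacobi_iff:
  "(x, y) \<in> adjoint_graph (closure (jacobi_graph0 q b)) \<longleftrightarrow> (\<forall>k. coord y k = trow q b (coord x) k)"
proof
  assume adj: "(x, y) \<in> adjoint_graph (closure (jacobi_graph0 q b))"
  show "\<forall>k. coord y k = trow q b (coord x) k"
  proof
    fix k
    obtain \<psi> where \<psi>: "(delta k, \<psi>) \<in> jacobi_graph0 q b"
      using jacobi_delta by blast
    then have "cinner_ell2 x \<psi> = cinner_ell2 y (delta k)"
      using adj closure_subset[of "jacobi_graph0 q b"] by (auto simp: adjoint_graph_def)
    moreover have "coord \<psi> n = trow q b (coord (delta k)) n" for n
      using \<psi> by (simp add: jacobi_graph0_def jacobi_row_eq_trow)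
    moreover have "cinner_ell2 x \<psi> = (\<Sum>n<Suc (Suc k). cnj (coord x n) * coord \<psi> n)"
      unfolding cinner_ell2_def
      by (rule suminf_finite) (auto simp: \<psi> calculation(2) trow_def delta.rep_eq)
    moreover have "(\<Sum>n<Suc (Suc k). cnj (coord x n) * coord \<psi> n)
        = (\<Sum>n<Suc (Suc k). trow q b (\<lambda>n. cnj (coord x n)) n * coord (delta k) n)"
      unfolding calculation(2) by (rule trow_green_finite) (simp add: delta.rep_eq)
    moreover have "\<dots> = cnj (trow q b (coord x) k)"
      by (simp add: trow_cnj delta.rep_eq)
    moreover have "cinner_ell2 y (delta k) = cnj (coord y k)"
      by (metis cinner_commute cinner_delta)
    ultimately show "coord y k = trow q b (coord x) k"
      by (metis complex_cnj_cancel_iff)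
  qed
next
  assume row: "\<forall>k. coord y k = trow q b (coord x) k"
  have "cinner_ell2 x v = cinner_ell2 y u" if uv: "(u, v) \<in> closure (jacobi_graph0 q b)" for u v
  proof -
    obtain p where p: "\<And>n. p n \<in> jacobi_graph0 q b" "p \<longlonglongrightarrow> (u, v)"
      using uv unfolding closure_sequential by blast
    have "cinner_ell2 x (snd (p n)) = cinner_ell2 y (fst (p n))" for n
      using p(1)[of n] row by (intro graph0_cinner) auto
    moreover have "(\<lambda>n. cinner_ell2 x (snd (p n))) \<longlonglongrightarrow> cinner_ell2 x v"
      using tendsto_cinner[OF tendsto_const tendsto_snd[OF p(2)]] by simp
    moreover have "(\<lambda>n. cinner_ell2 y (fst (p n))) \<longlonglongrightarrow> cinner_ell2 y u"
      using tendsto_cinner[OF tendsto_const tendsto_fst[OF p(2)]] by simp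
    ultimately show ?thesis
      by (auto intro: LIMSEQ_unique)
  qed
  then show "(x, y) \<in> adjoint_graph (closure (jacobi_graph0 q b))"
    by (auto simp: adjoint_graph_def)
qed

text \<open>Coefficients of the divided difference \<open>(p(t) - p(z)) / (t - z)\<close>, where
  \<open>p\<close> is the combination of orthogonal polynomials with coefficients \<open>a\<close>.
  Truncation at \<open>N\<close> loses nothing, as \<open>green_fun\<close> is triangular.\<close>

definition resolvent_vec :: "complex \<Rightarrow> nat \<Rightarrow> (nat \<Rightarrow> complex) \<Rightarrow> ell2" where
  "resolvent_vec z N a = finvec N (\<lambda>m. \<Sum>k<N. a k * green_fun q b z m k)"

lemma coord_resolvent_vec: "coord (resolvent_vec z N a) m = (\<Sum>k<N. a k * green_fun q b z m k)"
  by (auto simp: resolvent_vec_def coord_finvec green_fun_eq_0)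

text \<open>Multiplying the divided difference by \<open>t - z\<close> gives
  \<open>p(t) - p(z)\<close>, so the resolvent equation for \<open>a\<close> holds up to the
  multiple \<open>p(z)\<close> of \<open>delta 0\<close>.\<close>

lemma resolvent_vec_graph0:
  "(resolvent_vec z N a,
    scale_ell2 z (resolvent_vec z N a) + finvec N a - scale_ell2 (\<Sum>k<N. a k * opoly q b z k) (delta 0))
   \<in> jacobi_graph0 q b"
proof -
  have "{k. coord (resolvent_vec z N a) k \<noteq> 0} \<subseteq> {..<N}"
    by (auto simp: resolvent_vec_def coord_finvec)
  then have fin: "finite {k. coord (resolvent_vec z N a) k \<noteq> 0}"
    by (rule finite_subset) simp
  have coords: "coord (resolvent_vec z N a) = (\<lambda>m. \<Sum>k<N. a k * green_fun q b z m k)"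
    by (simp add: fun_eq_iff coord_resolvent_vec)
  have "trow q b (coord (resolvent_vec z N a)) m
      = z * (\<Sum>k<N. a k * green_fun q b z m k) + (if m < N then a m else 0)
        - (\<Sum>k<N. a k * opoly q b z k) * (if m = 0 then 1 else 0)" for m
  proof -
    have "trow q b (coord (resolvent_vec z N a)) m
      = (\<Sum>k<N. a k * (z * green_fun q b z m k + (if m = k then 1 else 0) - (if m = 0 then opoly q b z k else 0)))"
      by (simp only: coords trow_sum trow_scale trow_green_fun_column)
    also have "\<dots> = (\<Sum>k<N. z * (a k * green_fun q b z m k) + (if m = k then a m else 0)
        - a k * opoly q b z k * (if m = 0 then 1 else 0))"
      by (intro sum.cong) (auto simp: algebra_simps)
    finally show ?thesis
      by (simp add: sum.distrib sum_subtractf sum_distrib_left sum_distrib_right)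
  qed
  with fin show ?thesis
    by (auto simp: jacobi_graph0_def jacobi_row_eq_trow plus_ell2.rep_eq coord_diff scale_ell2.rep_eq
        coord_finvec delta.rep_eq coord_resolvent_vec)
qed

lemma resolvent_vec_bound:
  "\<bar>Im z\<bar> * norm (resolvent_vec z N a) \<le> norm (finvec N a) + cmod (\<Sum>k<N. a k * opoly q b z k)"
proof -
  have "\<bar>Im z\<bar> * norm (resolvent_vec z N a)
      \<le> norm (finvec N a - scale_ell2 (\<Sum>k<N. a k * opoly q b z k) (delta 0))"
    using graph0_bound[OF resolvent_vec_graph0[of z N a], of z] by (simp add: algebra_simps)
  also have "\<dots> \<le> norm (finvec N a) + norm (scale_ell2 (\<Sum>k<N. a k * opoly q b z k) (delta 0))"
    by (rule norm_triangle_ineq4)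
  finally show ?thesis
    by (simp add: norm_scale_ell2 norm_delta)
qed

text \<open>
  The second solution is square summable by duality: testing \<open>resolvent_vec_bound\<close> in its
  \<open>0\<close>-th coordinate shows that pairing with it is a bounded functional.
\<close>

lemma square_summable_green_fun:
  assumes P: "square_summable (opoly q b z)" and z: "Im z \<noteq> 0"
  shows "square_summable (green_fun q b z 0)"
proof -
  let ?Q = "green_fun q b z 0" and ?P = "opoly q b z"
  have "coord (Abs_ell2 ?P) = ?P"
    using P by (intro Abs_ell2_inverse) simp
  then have Pn: "norm (finvec N ?P) \<le> norm (Abs_ell2 ?P)" for N
    using norm_finvec_coord_le[of N "Abs_ell2 ?P"] by simp
  define p where "p = norm (Abs_ell2 ?P)"
  have bound: "(\<Sum>k<N. (cmod (?Q k))\<^sup>2) \<le> ((1 + p) / \<bar>Im z\<bar>)\<^sup>2" for N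
  proof -
    \<comment> \<open>With conjugated values the zeroth coordinate of the resolvent vector is the
      square of \<open>s\<close>, while its bound is linear in \<open>s\<close>. Cancelling
      \<open>s\<close> gives a bound uniform in \<open>N\<close>.\<close>
    let ?a = "\<lambda>k. cnj (?Q k)"
    define s where "s = norm (finvec N ?Q)"
    have s2: "s\<^sup>2 = (\<Sum>k<N. (cmod (?Q k))\<^sup>2)"
      by (simp add: s_def norm_finvec_power2)
    have sa: "norm (finvec N ?a) = s"
      by (rule power2_eq_imp_eq) (simp_all add: norm_finvec_power2 s2, simp add: s_def)
    have "coord (resolvent_vec z N ?a) 0 = complex_of_real (s\<^sup>2)"
      unfolding coord_resolvent_vec s2 of_real_sum
      by (intro sum.cong refl) (simp only: complex_norm_square mult.commute)
    then have "s\<^sup>2 \<le> norm (resolvent_vec z N ?a)"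
      using norm_coord_le[of "resolvent_vec z N ?a" 0] by (simp add: norm_power)
    then have "\<bar>Im z\<bar> * s\<^sup>2 \<le> \<bar>Im z\<bar> * norm (resolvent_vec z N ?a)"
      by (intro mult_left_mono) auto
    also have "\<dots> \<le> s + cmod (\<Sum>k<N. ?a k * ?P k)"
      using resolvent_vec_bound[of z N ?a] by (simp add: sa)
    also have "\<dots> \<le> s + s * p"
      using cauchy_schwarz_sum[where N = N and x = ?Q and y = ?P] Pn[of N]
        mult_left_mono[of "norm (finvec N ?P)" p s]
      by (simp add: s_def p_def)
    finally have "s * (\<bar>Im z\<bar> * s) \<le> s * (1 + p)"
      by (simp add: power2_eq_square algebra_simps)
    moreover have "0 \<le> s" "0 \<le> p" by (simp_all add: s_def p_def)
    ultimately have "\<bar>Im z\<bar> * s \<le> 1 + p"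
      by (cases "s = 0") (auto simp: mult_le_cancel_left)
    then have "s \<le> (1 + p) / \<bar>Im z\<bar>"
      using z by (simp add: field_simps)
    then show ?thesis
      unfolding s2[symmetric] using \<open>0 \<le> s\<close> by (intro power_mono)
  qed
  then show ?thesis
    unfolding square_summable_def by (intro summableI_nonneg_bounded) auto
qed

text \<open>Pairing with a sequence that is not square summable is an unbounded functional on finite
  vectors, so its kernel is dense. On the kernel \<open>resolvent_vec\<close> solves the resolvent
  equation exactly.\<close>

lemma range_dense:
  assumes P: "\<not> square_summable (opoly q b w)" and e: "0 < e"
  shows "\<exists>u v. (u, v) \<in> jacobi_graph0 q b \<and> norm (v - scale_ell2 w u - y) < e"
proof -
  let ?P = "opoly q b w"
  have "\<forall>\<^sub>F M in sequentially. dist (finvec M (coord y)) y < e / 2"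
    using e by (intro tendstoD[OF finvec_coord_tendsto]) auto
  then obtain M where M: "norm (finvec M (coord y) - y) < e / 2"
    by (auto simp: eventually_sequentially dist_norm)
  define F where "F = (\<Sum>k<M. coord y k * ?P k)"
  define S where "S N = (\<Sum>k<N. (cmod (?P k))\<^sup>2)" for N
  \<comment> \<open>Once \<open>S N\<close> exceeds \<open>B\<close>, the correction of norm
    \<open>cmod F / sqrt (S N)\<close> is below \<open>e / 2\<close>; the summand 1 keeps
    \<open>B\<close> positive when \<open>F = 0\<close>.\<close>
  define B where "B = (2 * (cmod F + 1) / e)\<^sup>2"
  have "\<exists>N. \<not> S N \<le> B"
  proof (rule ccontr)
    assume "\<not> ?thesis"
    then have "summable (\<lambda>k. (cmod (?P k))\<^sup>2)"
      by (intro summableI_nonneg_bounded[where x = B]) (auto simp: S_def)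
    then show False using P by (simp add: square_summable_def)
  qed
  then obtain N0 where N0: "S N0 > B" by (auto simp: not_le)
  define N where "N = max M N0"
  have "S N0 \<le> S N"
    unfolding S_def N_def by (intro sum_mono2) auto
  with N0 have SN: "S N > B" by simp
  moreover have "B > 0"
    unfolding B_def using e by (intro zero_less_power divide_pos_pos mult_pos_pos add_nonneg_pos) auto
  ultimately have SN0: "S N > 0" by linarith
  \<comment> \<open>Subtracting \<open>c\<close> times the conjugated polynomials puts the
    truncation of \<open>y\<close> into the kernel of the functional.\<close>
  define c where "c = F / S N"
  define a where "a k = (if k < M then coord y k else 0) - c * cnj (?P k)" for k
  have "(\<Sum>k<N. a k * ?P k)
      = (\<Sum>k<N. (if k < M then coord y k * ?P k else 0)) - (\<Sum>k<N. c * complex_of_real ((cmod (?P k))\<^sup>2))"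
    unfolding sum_subtractf[symmetric] complex_norm_square
    by (intro sum.cong) (auto simp: a_def algebra_simps)
  also have "(\<Sum>k<N. (if k < M then coord y k * ?P k else 0)) = F"
    unfolding F_def by (rule sum.mono_neutral_cong_right) (auto simp: N_def)
  also have "(\<Sum>k<N. c * complex_of_real ((cmod (?P k))\<^sup>2)) = c * S N"
    by (simp add: S_def sum_distrib_left)
  finally have F0: "(\<Sum>k<N. a k * ?P k) = 0"
    using SN0 by (simp add: c_def)
  have a: "finvec N a = finvec M (coord y) - scale_ell2 c (finvec N (\<lambda>k. cnj (?P k)))"
    by (rule ell2_eqI) (auto simp: coord_diff scale_ell2.rep_eq coord_finvec a_def N_def)
  have "(norm (scale_ell2 c (finvec N (\<lambda>k. cnj (?P k)))))\<^sup>2 = (cmod c)\<^sup>2 * S N"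
    by (simp add: norm_scale_ell2 power_mult_distrib norm_finvec_power2 S_def)
  also have "\<dots> = (cmod F)\<^sup>2 / S N"
    using SN0 by (simp add: c_def norm_divide power_divide power2_eq_square)
  also have "\<dots> < (e / 2)\<^sup>2"
  proof -
    have "(cmod F)\<^sup>2 < (cmod F + 1)\<^sup>2"
      by (intro power_strict_mono) auto
    also have "\<dots> = (e / 2)\<^sup>2 * B"
    proof -
      have "(e / 2)\<^sup>2 * B = (e / 2 * (2 * (cmod F + 1) / e))\<^sup>2"
        unfolding B_def by (rule power_mult_distrib[symmetric])
      also have "e / 2 * (2 * (cmod F + 1) / e) = cmod F + 1"
        using e by simp
      finally show ?thesis by simp
    qed
    also have "\<dots> < (e / 2)\<^sup>2 * S N"
      using SN e by simp
    finally show ?thesis using SN0 by (simp add: divide_less_eq)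
  qed
  finally have c: "norm (scale_ell2 c (finvec N (\<lambda>k. cnj (?P k)))) < e / 2"
    by (rule power2_less_imp_less) (use e in simp)
  have "norm (finvec N a - y)
      \<le> norm (finvec M (coord y) - y) + norm (scale_ell2 c (finvec N (\<lambda>k. cnj (?P k))))"
    using norm_triangle_ineq4[of "finvec M (coord y) - y" "scale_ell2 c (finvec N (\<lambda>k. cnj (?P k)))"]
    by (simp add: a algebra_simps)
  also have "\<dots> < e" using c M by simp
  finally have "norm (finvec N a - y) < e" .
  moreover have "(resolvent_vec w N a, scale_ell2 w (resolvent_vec w N a) + finvec N a) \<in> jacobi_graph0 q b"
    using resolvent_vec_graph0[of w N a] by (simp add: F0)
  ultimately show ?thesis
    by (intro exI[of _ "resolvent_vec w N a"] exI[of _ "scale_ell2 w (resolvent_vec w N a) + finvec N a"]) simp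
qed

text \<open>For \<open>(x, y)\<close> in the adjoint, \<open>y - scale_ell2 w x\<close> is
  approximated from the range; \<open>graph0_bound\<close> makes the preimages converge to some
  \<open>l\<close>. Then \<open>x - l\<close> is a square-summable formal eigenvector, hence a
  multiple of \<open>opoly q b w\<close>, hence 0.\<close>

lemma self_adjoint_limit_point:
  assumes P: "\<not> square_summable (opoly q b w)" and w: "Im w \<noteq> 0"
  shows "self_adjoint (closure (jacobi_graph0 q b))"
proof -
  let ?G = "jacobi_graph0 q b"
  have "(x, y) \<in> closure ?G" if xy: "\<And>k. coord y k = trow q b (coord x) k" for x y
  proof -
    define e where "e = y - scale_ell2 w x"
    have "\<exists>p. p \<in> ?G \<and> norm (snd p - scale_ell2 w (fst p) - e) < inverse (real (Suc n))" for n
      using range_dense[OF P, of "inverse (real (Suc n))" e] by auto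
    then obtain p where p: "\<And>n. p n \<in> ?G"
      "\<And>n. norm (snd (p n) - scale_ell2 w (fst (p n)) - e) < inverse (real (Suc n))"
      by metis
    define d where "d n = snd (p n) - scale_ell2 w (fst (p n))" for n
    have "(\<lambda>n. d n - e) \<longlonglongrightarrow> 0"
    proof (rule Lim_null_comparison[OF _ LIMSEQ_inverse_real_of_nat])
      show "\<forall>\<^sub>F n in sequentially. norm (d n - e) \<le> inverse (real (Suc n))"
        unfolding d_def by (intro always_eventually allI less_imp_le p(2))
    qed
    then have d: "d \<longlonglongrightarrow> e" by (rule LIM_zero_cancel)
    have diff: "\<bar>Im w\<bar> * norm (fst (p m) - fst (p n)) \<le> norm (d m - d n)" for m n
    proof -
      have "(fst (p m) - fst (p n), snd (p m) - snd (p n)) \<in> ?G"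
        using p(1)[of m] p(1)[of n] by (intro graph0_diff) auto
      from graph0_bound[OF this, of w] show ?thesis
        by (simp add: d_def ell2.scale_right_diff_distrib algebra_simps)
    qed
    have "Cauchy (\<lambda>n. fst (p n))"
    proof (rule CauchyI)
      fix r :: real assume "0 < r"
      then obtain M where M: "\<And>m n. m \<ge> M \<Longrightarrow> n \<ge> M \<Longrightarrow> norm (d m - d n) < \<bar>Im w\<bar> * r"
        using CauchyD[OF LIMSEQ_imp_Cauchy[OF d], of "\<bar>Im w\<bar> * r"] w by auto
      have "norm (fst (p m) - fst (p n)) < r" if "m \<ge> M" "n \<ge> M" for m n
        using order_le_less_trans[OF diff M[OF that]] w by simp
      then show "\<exists>M. \<forall>m\<ge>M. \<forall>n\<ge>M. norm (fst (p m) - fst (p n)) < r" by blast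
    qed
    then obtain l where l: "(\<lambda>n. fst (p n)) \<longlonglongrightarrow> l"
      using Cauchy_ell2_convergent by blast
    have "(\<lambda>n. (fst (p n), d n + scale_ell2 w (fst (p n)))) \<longlonglongrightarrow> (l, e + scale_ell2 w l)"
      by (intro tendsto_intros l d tendsto_scale_ell2)
    then have lc: "(l, e + scale_ell2 w l) \<in> closure ?G"
      unfolding closure_sequential using p(1) by (auto simp: d_def)
    define s where "s = coord (x - l)"
    have "trow q b s k = w * s k" for k
      using jacobi_closure_row[OF lc, of k] xy[of k]
      by (simp add: s_def trow_diff jacobi_row_eq_trow e_def plus_ell2.rep_eq coord_diff_fun
          scale_ell2.rep_eq algebra_simps)
    then have s: "s n = s 0 * opoly q b w n" for n
      by (rule eigenvector_eq_opoly)
    have s0: "s 0 = 0"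
    proof (rule ccontr)
      assume s0: "s 0 \<noteq> 0"
      have "opoly q b w n = inverse (s 0) * s n" for n
        by (subst s) (use s0 in simp)
      then have "opoly q b w = (\<lambda>n. inverse (s 0) * coord (x - l) n)"
        unfolding s_def by (rule ext)
      then have "square_summable (opoly q b w)"
        using square_summable_scale[OF square_summable_coord, of "inverse (s 0)" "x - l"] by simp
      then show False using P by simp
    qed
    have "s n = 0" for n
      by (subst s) (simp add: s0)
    then have "x = l"
      by (intro ell2_eqI) (simp add: s_def coord_diff)
    then show ?thesis using lc by (simp add: e_def)
  qed
  moreover have "coord y k = trow q b (coord x) k" if "(x, y) \<in> closure ?G" for x y k
    using jacobi_closure_row[OF that] by (simp add: jacobi_row_eq_trow)
  ultimately have "(x, y) \<in> adjoint_graph (closure ?G) \<longleftrightarrow> (x, y) \<in> closure ?G" for x y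
    unfolding adjoint_jacobi_iff by blast
  then show ?thesis
    unfolding self_adjoint_def by (intro set_eqI) (simp only: split_paired_all)
qed

end

section \<open>Growth, analyticity and totality of the vectors \<pi>(z)\<close>

section \<open>The limit circle case\<close>

locale limit_circle = jacobi_parameters +
  assumes square_summable_opoly_ii: "square_summable (opoly q b \<i>)"
begin

definition weight :: "nat \<Rightarrow> real" where
  "weight n = (cmod (opoly q b \<i> n))\<^sup>2 + (cmod (green_fun q b \<i> 0 n))\<^sup>2"

lemma summable_weight: "summable weight"
  using square_summable_opoly_ii square_summable_green_fun[OF square_summable_opoly_ii]
  unfolding weight_def square_summable_def by (intro summable_add) auto

lemma weight_nonneg: "0 \<le> weight n"
  by (simp add: weight_def)

text \<open>Cauchy-Schwarz in the plane, applied to the two-term formula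
  \<open>green_fun_eq\<close>; the defect is a perfect square.\<close>

lemma green_fun_ii_le: "cmod (green_fun q b \<i> k n) \<le> sqrt (weight k) * sqrt (weight n)"
proof (cases "n \<le> k")
  case False
  let ?P = "opoly q b \<i>" and ?Q = "green_fun q b \<i> 0"
  have "cmod (green_fun q b \<i> k n) \<le> cmod (?P k) * cmod (?Q n) + cmod (?Q k) * cmod (?P n)"
    using False norm_triangle_ineq4[of "?P k * ?Q n" "?Q k * ?P n"]
    by (subst green_fun_eq) (simp add: norm_mult)
  also have "\<dots> \<le> sqrt (weight k * weight n)"
  proof (rule real_le_rsqrt)
    have "weight k * weight n - (cmod (?P k) * cmod (?Q n) + cmod (?Q k) * cmod (?P n))\<^sup>2
        = (cmod (?P k) * cmod (?P n) - cmod (?Q k) * cmod (?Q n))\<^sup>2"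
      by (simp add: weight_def power2_eq_square algebra_simps)
    then show "(cmod (?P k) * cmod (?Q n) + cmod (?Q k) * cmod (?P n))\<^sup>2 \<le> weight k * weight n"
      by (smt (verit) zero_le_power2)
  qed
  finally show ?thesis by (simp add: real_sqrt_mult)
qed (simp add: green_fun_eq_0 weight_nonneg)

text \<open>Inserting the product bound on the Green function into \<open>opoly_shift\<close> at
  \<i> lets \<open>sqrt (weight n)\<close> be factored out; the remaining factor \<open>U\<close>
  obeys the Gronwall inequality.\<close>

lemma opoly_le:
  "cmod (opoly q b z n) \<le> sqrt (weight n) * (\<Prod>k<n. 1 + cmod (z - \<i>) * weight k)"
proof -
  define U where "U n = 1 + cmod (z - \<i>) * (\<Sum>k<n. sqrt (weight k) * cmod (opoly q b z k))" for n
  have P: "cmod (opoly q b z n) \<le> sqrt (weight n) * U n" for n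
  proof -
    have "cmod (opoly q b z n) \<le> cmod (opoly q b \<i> n)
        + cmod (z - \<i>) * cmod (\<Sum>k<n. green_fun q b \<i> k n * opoly q b z k)"
      by (subst opoly_shift[of z n "\<i>"]) (metis norm_mult norm_triangle_ineq)
    also have "\<dots> \<le> sqrt (weight n)
        + cmod (z - \<i>) * (\<Sum>k<n. sqrt (weight k) * sqrt (weight n) * cmod (opoly q b z k))"
    proof (intro add_mono mult_left_mono sum_norm_le)
      show "cmod (opoly q b \<i> n) \<le> sqrt (weight n)"
        by (rule real_le_rsqrt) (simp add: weight_def)
      show "cmod (green_fun q b \<i> k n * opoly q b z k)
          \<le> sqrt (weight k) * sqrt (weight n) * cmod (opoly q b z k)" for k
        unfolding norm_mult by (intro mult_right_mono green_fun_ii_le) simp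
    qed simp
    also have "\<dots> = sqrt (weight n) * U n"
      by (simp add: U_def algebra_simps sum_distrib_left)
    finally show ?thesis .
  qed
  have "U n \<le> 1 + cmod (z - \<i>) * (\<Sum>k<n. weight k * U k)" for n
  proof -
    have "sqrt (weight k) * cmod (opoly q b z k) \<le> weight k * U k" for k
      using mult_left_mono[OF P[of k], of "sqrt (weight k)"] weight_nonneg[of k]
      by (simp add: mult.assoc[symmetric])
    then show ?thesis
      unfolding U_def[of n] by (intro add_left_mono mult_left_mono sum_mono) auto
  qed
  then have "U n \<le> (\<Prod>k<n. 1 + cmod (z - \<i>) * weight k)"
    by (intro discrete_gronwall weight_nonneg) auto
  then show ?thesis
    using order_trans[OF P mult_left_mono] weight_nonneg by auto
qed

lemma opoly_minimal_type:
  assumes "0 < e"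
  shows "\<exists>C\<ge>0. \<forall>z n. cmod (opoly q b z n) \<le> sqrt (weight n) * (C * exp (e * cmod z))"
proof -
  obtain C where C: "\<And>t n. t \<ge> 0 \<Longrightarrow> (\<Prod>k<n. 1 + t * weight k) \<le> C * exp (e * t)"
    using prod_one_plus_minimal_type[OF summable_weight weight_nonneg assms] by blast
  have "1 \<le> C" using C[of 0 0] by simp
  have "cmod (opoly q b z n) \<le> sqrt (weight n) * (C * exp e * exp (e * cmod z))" for z n
  proof -
    have "C * exp (e * cmod (z - \<i>)) \<le> C * exp (e * (cmod z + 1))"
      using norm_triangle_ineq4[of z "\<i>"] assms \<open>1 \<le> C\<close> by simp
    also have "\<dots> = C * exp e * exp (e * cmod z)"
      by (simp add: exp_add algebra_simps)
    finally have "(\<Prod>k<n. 1 + cmod (z - \<i>) * weight k) \<le> C * exp e * exp (e * cmod z)"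
      using C[of "cmod (z - \<i>)" n] by simp
    then show ?thesis
      using order_trans[OF opoly_le mult_left_mono] weight_nonneg by auto
  qed
  then show ?thesis
    using \<open>1 \<le> C\<close> by (intro exI[of _ "C * exp e"]) auto
qed

lemma square_summable_opoly_le:
  assumes D: "0 \<le> D" "\<And>n. cmod (opoly q b z n) \<le> sqrt (weight n) * D"
  shows "square_summable (opoly q b z)" "(\<Sum>n. (cmod (opoly q b z n))\<^sup>2) \<le> (sqrt (suminf weight) * D)\<^sup>2"
proof -
  have le: "(cmod (opoly q b z n))\<^sup>2 \<le> weight n * D\<^sup>2" for n
    using power_mono[OF D(2)[of n], of 2] weight_nonneg[of n] by (simp add: power_mult_distrib)
  have sm: "summable (\<lambda>n. weight n * D\<^sup>2)"
    by (intro summable_mult2 summable_weight)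
  show ss: "square_summable (opoly q b z)"
    unfolding square_summable_def
    by (rule summable_comparison_test'[where N = 0, OF sm]) (simp add: le)
  have "(\<Sum>n. (cmod (opoly q b z n))\<^sup>2) \<le> (\<Sum>n. weight n * D\<^sup>2)"
    using ss sm unfolding square_summable_def by (intro suminf_le le)
  also have "\<dots> = suminf weight * D\<^sup>2"
    by (rule suminf_mult2[symmetric, OF summable_weight])
  also have "\<dots> = (sqrt (suminf weight) * D)\<^sup>2"
    using suminf_nonneg[OF summable_weight weight_nonneg] by (simp add: power_mult_distrib)
  finally show "(\<Sum>n. (cmod (opoly q b z n))\<^sup>2) \<le> (sqrt (suminf weight) * D)\<^sup>2" .
qed

definition opoly_vec :: "complex \<Rightarrow> ell2" where
  "opoly_vec z = Abs_ell2 (opoly q b z)"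

text \<open>For fixed \<open>z\<close> the growth bound dominates the polynomials by a multiple of
  \<open>sqrt (weight n)\<close>, so square summability spreads from \<i> to every \<open>z\<close>,
  real ones included.\<close>

lemma coord_opoly_vec: "coord (opoly_vec z) = opoly q b z"
proof -
  obtain C where "C \<ge> 0" "\<forall>z n. cmod (opoly q b z n) \<le> sqrt (weight n) * (C * exp (1 * cmod z))"
    using opoly_minimal_type[of 1] by auto
  then have "square_summable (opoly q b z)"
    by (intro square_summable_opoly_le(1)[of "C * exp (1 * cmod z)"]) auto
  then show ?thesis
    unfolding opoly_vec_def by (intro Abs_ell2_inverse) simp
qed

lemma opoly_vec_minimal_type:
  assumes "0 < e"
  shows "\<exists>C\<ge>0. \<forall>z. norm (opoly_vec z) \<le> C * exp (e * cmod z)"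
proof -
  obtain C where C: "C \<ge> 0" "\<And>z n. cmod (opoly q b z n) \<le> sqrt (weight n) * (C * exp (e * cmod z))"
    using opoly_minimal_type[OF assms] by blast
  let ?W = "sqrt (suminf weight)"
  have W: "?W \<ge> 0"
    using suminf_nonneg[OF summable_weight weight_nonneg] by simp
  have "norm (opoly_vec z) \<le> ?W * C * exp (e * cmod z)" for z
  proof (rule power2_le_imp_le)
    show "(norm (opoly_vec z))\<^sup>2 \<le> (?W * C * exp (e * cmod z))\<^sup>2"
      unfolding norm_ell2_power2 coord_opoly_vec mult.assoc
      using C by (intro square_summable_opoly_le(2)) auto
  qed (use W C in simp)
  then show ?thesis
    using W C by (intro exI[of _ "?W * C"]) auto
qed

lemma opoly_vec_bounded: "\<exists>C. \<forall>z. cmod z \<le> r \<longrightarrow> norm (opoly_vec z) \<le> C"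
proof -
  obtain C where "C \<ge> 0" "\<And>z. norm (opoly_vec z) \<le> C * exp (1 * cmod z)"
    using opoly_vec_minimal_type[of 1] by auto
  then have "norm (opoly_vec z) \<le> C * exp r" if "cmod z \<le> r" for z
    using that order_trans[of "norm (opoly_vec z)" "C * exp (1 * cmod z)" "C * exp r"]
    by (auto intro: mult_left_mono)
  then show ?thesis by blast
qed

text \<open>Truncating \<open>x\<close> gives polynomials in \<open>z\<close>; they converge
  uniformly on discs because \<open>opoly_vec\<close> is bounded there.\<close>

lemma holomorphic_cinner_opoly_vec: "(\<lambda>z. cinner_ell2 x (opoly_vec z)) holomorphic_on UNIV"
proof (rule holomorphic_uniform_sequence)
  let ?f = "\<lambda>N z. cinner_ell2 (finvec N (coord x)) (opoly_vec z)"
  show "?f N holomorphic_on UNIV" for N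
    unfolding cinner_finvec coord_opoly_vec opoly_def
    by (intro holomorphic_intros holomorphic_tri_sol)
  fix a :: complex
  have "uniform_limit (cball a 1) ?f (\<lambda>z. cinner_ell2 x (opoly_vec z)) sequentially"
  proof (rule uniform_limitI)
    fix e :: real assume e: "0 < e"
    obtain C where C: "\<And>z. cmod z \<le> cmod a + 1 \<Longrightarrow> norm (opoly_vec z) \<le> C"
      using opoly_vec_bounded[of "cmod a + 1"] by blast
    have C0: "C \<ge> 0" using order_trans[OF norm_ge_zero C[of a]] by simp
    have "\<forall>\<^sub>F N in sequentially. dist (finvec N (coord x)) x < e / (C + 1)"
      using e C0 by (intro tendstoD[OF finvec_coord_tendsto]) auto
    then show "\<forall>\<^sub>F N in sequentially. \<forall>z\<in>cball a 1. dist (?f N z) (cinner_ell2 x (opoly_vec z)) < e"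
    proof (eventually_elim, intro ballI)
      fix N z assume N: "dist (finvec N (coord x)) x < e / (C + 1)" and z: "z \<in> cball a 1"
      have "cmod z \<le> cmod a + 1"
        using z norm_triangle_ineq[of a "z - a"] by (simp add: dist_norm norm_minus_commute)
      then have "norm (opoly_vec z) < C + 1" using C[of z] by simp
      have "dist (?f N z) (cinner_ell2 x (opoly_vec z)) \<le> norm (finvec N (coord x) - x) * norm (opoly_vec z)"
        using cinner_cauchy_schwarz[of "finvec N (coord x) - x" "opoly_vec z"]
        by (simp add: dist_norm cinner_diff_left)
      also have "\<dots> \<le> norm (finvec N (coord x) - x) * (C + 1)"
        using \<open>norm (opoly_vec z) < C + 1\<close> by (intro mult_left_mono) auto
      also have "\<dots> < e"
        using N C0 by (simp add: dist_norm less_divide_eq)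
      finally show "dist (?f N z) (cinner_ell2 x (opoly_vec z)) < e" .
    qed
  qed
  then show "\<exists>d>0. cball a d \<subseteq> UNIV \<and> uniform_limit (cball a d) ?f (\<lambda>z. cinner_ell2 x (opoly_vec z)) sequentially"
    by (intro exI[of _ 1]) auto
qed simp

text \<open>
  On the circle \<open>cmod z = R\<close> one has
  \<open>cmod (z\<^sup>2 - R\<^sup>2) = 2 * R * \<bar>Im z\<bar>\<close>, so this factor cancels the pole of the bound on the
  resolvent vectors on the real axis.
\<close>

lemma opoly_vec_total:
  assumes x: "\<And>z. cinner_ell2 x (opoly_vec z) = 0"
  shows "x = 0"
proof -
  \<comment> \<open>The truncated resolvent equation at 0 with right-hand side \<open>a\<close> has
    an error multiple of \<open>delta 0\<close> that tends to 0 by orthogonality. If its solutions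
    \<open>y N m 0\<close> also tend to 0 coordinatewise, then \<open>a = 0\<close>.\<close>
  define a where "a k = cnj (coord x k)" for k
  define y where "y N m z = coord (resolvent_vec z N a) m" for N m z
  have norm_a: "norm (finvec N a) \<le> norm x" for N
  proof -
    have "(norm (finvec N a))\<^sup>2 = (norm (finvec N (coord x)))\<^sup>2"
      unfolding norm_finvec_power2 by (simp add: a_def)
    then show ?thesis
      using norm_finvec_coord_le[of N x] by (simp add: power2_eq_iff_nonneg)
  qed
  have F: "(\<Sum>k<N. a k * opoly q b z k) = cinner_ell2 (finvec N (coord x) - x) (opoly_vec z)" for N z
    by (simp add: cinner_diff_left x cinner_finvec coord_opoly_vec a_def)
  have y0: "cmod (y N m 0) \<le> 2 * (norm x + norm (finvec N (coord x) - x) * C) / R"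
    if R: "R > 0" and C: "\<And>z. cmod z \<le> R \<Longrightarrow> norm (opoly_vec z) \<le> C" for N m R C
  proof -
    let ?B = "norm x + norm (finvec N (coord x) - x) * C"
    define H where "H z = (z\<^sup>2 - (complex_of_real R)\<^sup>2) * y N m z" for z
    have hol: "H holomorphic_on UNIV"
      unfolding H_def y_def coord_resolvent_vec green_fun_def
      by (intro holomorphic_intros holomorphic_tri_sol)
    have "cmod (H 0) \<le> 2 * R * ?B"
    proof (rule maximum_modulus_frontier[of H "cball 0 R"])
      show "H holomorphic_on interior (cball 0 R)"
        by (rule holomorphic_on_subset[OF hol]) simp
      show "continuous_on (closure (cball 0 R)) H"
        by (rule continuous_on_subset[OF holomorphic_on_imp_continuous_on[OF hol]]) simp
      fix z assume "z \<in> frontier (cball (0::complex) R)"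
      then have z: "cmod z = R" by (simp add: frontier_cball)
      have "z\<^sup>2 - (complex_of_real R)\<^sup>2 = z * (z - cnj z)"
        unfolding z[symmetric] using complex_norm_square[of z]
        by (simp add: power2_eq_square algebra_simps)
      then have "cmod (H z) = 2 * R * (\<bar>Im z\<bar> * cmod (y N m z))"
        using R by (simp add: H_def norm_mult z complex_diff_cnj)
      also have "\<dots> \<le> 2 * R * (\<bar>Im z\<bar> * norm (resolvent_vec z N a))"
        unfolding y_def using R by (intro mult_left_mono norm_coord_le) auto
      also have "\<dots> \<le> 2 * R * ?B"
      proof (intro mult_left_mono)
        have "cmod (\<Sum>k<N. a k * opoly q b z k) \<le> norm (finvec N (coord x) - x) * norm (opoly_vec z)"
          unfolding F by (rule cinner_cauchy_schwarz)
        also have "\<dots> \<le> norm (finvec N (coord x) - x) * C"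
          using C[of z] z by (intro mult_left_mono) auto
        finally show "\<bar>Im z\<bar> * norm (resolvent_vec z N a) \<le> ?B"
          using resolvent_vec_bound[of z N a] norm_a[of N] by linarith
      qed (use R in simp)
      finally show "cmod (H z) \<le> 2 * R * ?B" .
    qed (use R in auto)
    then have "R * (R * cmod (y N m 0)) \<le> R * (2 * ?B)"
      by (simp add: H_def norm_mult norm_power power2_eq_square mult_ac)
    then have "R * cmod (y N m 0) \<le> 2 * ?B"
      using R by (simp only: mult_le_cancel_left_pos)
    then show ?thesis
      using R by (simp add: field_simps)
  qed
  have lim: "(\<lambda>N. y N m 0) \<longlonglongrightarrow> 0" for m
  proof (rule tendstoI)
    fix e :: real assume e: "0 < e"
    \<comment> \<open>This \<open>R\<close> brings the bound of \<open>y0\<close> below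
      \<open>e\<close> once the truncation error times \<open>C\<close> is below 1. As
      \<open>C\<close> depends on \<open>R\<close>, the index \<open>N\<close> is chosen
      last.\<close>
    define R where "R = 2 * (norm x + 1) / e"
    have R: "R > 0"
      unfolding R_def using e by (intro divide_pos_pos mult_pos_pos add_nonneg_pos) auto
    obtain C where C: "\<And>z. cmod z \<le> R \<Longrightarrow> norm (opoly_vec z) \<le> C"
      using opoly_vec_bounded[of R] by blast
    have "(\<lambda>N. norm (finvec N (coord x) - x) * C) \<longlonglongrightarrow> 0"
      using finvec_coord_tendsto[of x] by (intro tendsto_mult_left_zero tendsto_norm_zero LIM_zero)
    then have "\<forall>\<^sub>F N in sequentially. norm (finvec N (coord x) - x) * C < 1"
      by (rule order_tendstoD) simp
    then show "\<forall>\<^sub>F N in sequentially. dist (y N m 0) 0 < e"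
    proof eventually_elim
      case (elim N)
      have "cmod (y N m 0) \<le> 2 * (norm x + norm (finvec N (coord x) - x) * C) / R"
        by (rule y0[OF R C])
      also have "\<dots> < 2 * (norm x + 1) / R"
        using elim R by (intro divide_strict_right_mono) auto
      also have "\<dots> = e"
        using R e by (simp add: R_def field_simps)
      finally show ?case by simp
    qed
  qed
  have F_lim: "(\<lambda>N. \<Sum>k<N. a k * opoly q b 0 k) \<longlonglongrightarrow> 0"
    unfolding F
    using tendsto_cinner[OF LIM_zero[OF finvec_coord_tendsto[of x]] tendsto_const[of "opoly_vec 0"]]
    by simp
  have "a m = 0" for m
  proof -
    have "trow q b (\<lambda>m. y N m 0) m = a m - (\<Sum>k<N. a k * opoly q b 0 k) * coord (delta 0) m"
      if "N > m" for N
    proof -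
      have "trow q b (\<lambda>m. y N m 0) m
          = coord (scale_ell2 0 (resolvent_vec 0 N a) + finvec N a
              - scale_ell2 (\<Sum>k<N. a k * opoly q b 0 k) (delta 0)) m"
        using resolvent_vec_graph0[of 0 N a]
        unfolding jacobi_graph0_def jacobi_row_eq_trow y_def by auto
      then show ?thesis
        using that by (simp add: coord_diff coord_finvec scale_ell2.rep_eq)
    qed
    then have "\<forall>\<^sub>F N in sequentially. trow q b (\<lambda>m. y N m 0) m = a m - (\<Sum>k<N. a k * opoly q b 0 k) * coord (delta 0) m"
      by (auto intro: eventually_sequentiallyI[of "Suc m"])
    moreover have "(\<lambda>N. a m - (\<Sum>k<N. a k * opoly q b 0 k) * coord (delta 0) m) \<longlonglongrightarrow> a m - 0 * coord (delta 0) m"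
      by (intro tendsto_intros F_lim)
    ultimately have "(\<lambda>N. trow q b (\<lambda>m. y N m 0) m) \<longlonglongrightarrow> a m"
      using tendsto_cong[of "\<lambda>N. trow q b (\<lambda>m. y N m 0) m"] by simp
    moreover have "(\<lambda>N. trow q b (\<lambda>m. y N m 0) m) \<longlonglongrightarrow> trow q b (\<lambda>m. 0) m"
      by (intro trow_tendsto lim)
    ultimately show ?thesis
      using LIMSEQ_unique by (fastforce simp: trow_zero)
  qed
  then show ?thesis
    by (intro ell2_eqI) (simp add: a_def zero_ell2.rep_eq)
qed

end

section \<open>Bases giving a Jacobi matrix\<close>

definition tri_comb :: "(nat \<Rightarrow> real) \<Rightarrow> (nat \<Rightarrow> real) \<Rightarrow> (nat \<Rightarrow> ell2) \<Rightarrow> nat \<Rightarrow> ell2" where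
  "tri_comb q b u j =
     (if j = 0 then 0 else scale_ell2 (b (j - 1)) (u (j - 1))) +
     scale_ell2 (q j) (u j) + scale_ell2 (b j) (u (Suc j))"

text \<open>Both sides have the same coefficients with respect to \<open>u\<close>, namely column
  \<open>j\<close> of the matrix, and \<open>u\<close> is total.\<close>

lemma jacobi_basis_tri_comb:
  assumes br: "basis_of_representation J u" and mat: "matrix_representation J u = tridiagonal q b"
  shows "op_apply J (u j) = tri_comb q b u j"
proof -
  have onb: "orthonormal_basis u"
    using br by (simp add: basis_of_representation_def)
  then have u: "cinner_ell2 (u i) (u k) = (if i = k then 1 else 0)" for i k
    by (simp add: orthonormal_basis_def)
  have "op_apply J (u j) - tri_comb q b u j = 0"
  proof (rule orthonormal_basis_orthogonal_imp_zero[OF onb])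
    fix k
    have "cinner_ell2 (u k) (op_apply J (u j)) = tridiagonal q b k j"
      using fun_cong[OF fun_cong[OF mat, of k], of j] by (simp add: matrix_representation_def)
    moreover have "cinner_ell2 (u k) (tri_comb q b u j) = tridiagonal q b k j"
      by (auto simp: tri_comb_def cinner_add_right cinner_scale_right u tridiagonal_def)
    ultimately show "cinner_ell2 (u k) (op_apply J (u j) - tri_comb q b u j) = 0"
      by (simp add: cinner_diff_right)
  qed
  then show ?thesis by simp
qed

text \<open>The matrix entries are real, so antilinearity in the first argument leaves them
  unchanged.\<close>

lemma cinner_tri_comb: "cinner_ell2 (tri_comb q b u j) x = trow q b (\<lambda>k. cinner_ell2 (u k) x) j"
  by (simp add: tri_comb_def trow_def cinner_add_left cinner_scale_left)

section \<open>Expansion of \<pi>(z) in a second Jacobi basis\<close>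

context limit_circle
begin

lemma opoly_vec_adjoint:
  "(opoly_vec z, scale_ell2 z (opoly_vec z)) \<in> adjoint_graph (closure (jacobi_graph0 q b))"
  by (simp add: adjoint_jacobi_iff scale_ell2.rep_eq coord_opoly_vec trow_opoly)

lemma jacobi_basis_first_vector:
  assumes br: "basis_of_representation (closure (jacobi_graph0 q b)) v"
    and mat: "matrix_representation (closure (jacobi_graph0 q b)) v = tridiagonal q' b'"
    and b': "\<And>k. 0 < b' k"
  shows "\<exists>c. v 0 = scale_ell2 c (delta 0)"
proof -
  let ?J = "closure (jacobi_graph0 q b)"
  interpret other: jacobi_parameters q' b'
    by unfold_locales (rule b')
  have onb: "orthonormal_basis v" and dom: "\<And>k. v k \<in> Domain ?J" and op: "is_operator ?J"
    using br by (auto simp: basis_of_representation_def closed_operator_def)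
  define g where "g z = (\<lambda>k. cinner_ell2 (v k) (opoly_vec z))" for z
  have "trow q' b' (g z) k = z * g z k" for z k
  proof -
    have "cinner_ell2 (opoly_vec z) (op_apply ?J (v k)) = cinner_ell2 (scale_ell2 z (opoly_vec z)) (v k)"
      using opoly_vec_adjoint[of z] op_apply_graph[OF op dom[of k]] unfolding adjoint_graph_def by blast
    then have "cinner_ell2 (op_apply ?J (v k)) (opoly_vec z) = z * g z k"
      using cinner_commute[of "op_apply ?J (v k)" "opoly_vec z"]
      by (simp add: g_def cinner_scale_left cinner_commute[of "v k" "opoly_vec z"])
    then show ?thesis
      by (simp add: jacobi_basis_tri_comb[OF br mat] cinner_tri_comb g_def)
  qed
  then have g: "g z k = g z 0 * opoly q' b' z k" for z k
    by (rule other.eigenvector_eq_opoly)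
  define f where "f z = g z 0" for z
  have "f z = f 0" for z
  proof (rule zero_free_minimal_type_imp_constant)
    show "f holomorphic_on UNIV"
      unfolding f_def g_def by (rule holomorphic_cinner_opoly_vec)
    \<comment> \<open>A zero would annihilate every coefficient of \<pi>(z) with respect to
      \<open>v\<close>, whereas its coordinate 0 equals 1.\<close>
    show "f z \<noteq> 0" for z
    proof
      assume "f z = 0"
      then have "g z k = 0" for k
        by (subst g) (simp add: f_def)
      then have "opoly_vec z = 0"
        unfolding g_def by (intro orthonormal_basis_orthogonal_imp_zero[OF onb])
      then have "coord (opoly_vec z) 0 = 0"
        by (simp add: zero_ell2.rep_eq)
      then show False by (simp add: coord_opoly_vec)
    qed
    fix e :: real assume "0 < e"
    then obtain C where C: "C \<ge> 0" "\<And>z. norm (opoly_vec z) \<le> C * exp (e * cmod z)"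
      using opoly_vec_minimal_type by blast
    have "cmod (f z) \<le> norm (v 0) * C * exp (e * cmod z)" for z
      using order_trans[OF cinner_cauchy_schwarz mult_left_mono[OF C(2)[of z]], of "v 0"]
      by (simp add: f_def g_def mult.assoc)
    then show "\<exists>C. \<forall>z. cmod (f z) \<le> C * exp (e * cmod z)" by blast
  qed
  then have f: "f z = f 0" for z .
  \<comment> \<open>As \<open>delta 0\<close> pairs to 1 with every \<pi>(z), a constant
    \<open>f\<close> is matched by this multiple; the conjugate compensates antilinearity.\<close>
  have "v 0 - scale_ell2 (cnj (f 0)) (delta 0) = 0"
  proof (rule opoly_vec_total)
    fix z
    show "cinner_ell2 (v 0 - scale_ell2 (cnj (f 0)) (delta 0)) (opoly_vec z) = 0"
      using f[of z]
      by (simp add: cinner_diff_left cinner_scale_left cinner_delta coord_opoly_vec f_def g_def)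
  qed
  then show ?thesis by auto
qed

end

text \<open>If the bases are proportional up to index \<open>j\<close>, the matrix entries between
  those vectors agree. Comparing the images under \<open>J\<close> leaves only the terms in
  \<open>u (Suc j)\<close> and \<open>v (Suc j)\<close>; norms and positivity then give
  \<open>b' j = b j\<close>.\<close>

lemma jacobi_bases_proportional:
  assumes u: "basis_of_representation J u" "matrix_representation J u = tridiagonal q b" "\<And>k. 0 < b k"
    and v: "basis_of_representation J v" "matrix_representation J v = tridiagonal q' b'" "\<And>k. 0 < b' k"
    and c: "v 0 = scale_ell2 c (u 0)"
  shows "cmod c = 1" "v = (\<lambda>k. scale_ell2 c (u k))"
proof -
  have onu: "cinner_ell2 (u i) (u k) = (if i = k then 1 else 0)" for i k
    using u(1) by (simp add: basis_of_representation_def orthonormal_basis_def)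
  have onv: "cinner_ell2 (v i) (v k) = (if i = k then 1 else 0)" for i k
    using v(1) by (simp add: basis_of_representation_def orthonormal_basis_def)
  have J: "is_operator J" "\<And>k. u k \<in> Domain J"
    using u(1) by (auto simp: basis_of_representation_def closed_operator_def)
  have cc: "cnj c * c = 1"
    using onv[of 0 0] by (simp add: c cinner_scale onu)
  have norm1: "norm (u k) = 1" "norm (v k) = 1" for k
    by (simp_all add: cinner_self_eq_1 onu onv)
  show "cmod c = 1"
    using norm_scale_ell2[of c "u 0"] by (simp add: norm1 flip: c)
  have mat: "tridiagonal q' b' i k = tridiagonal q b i k"
    if "v i = scale_ell2 c (u i)" "v k = scale_ell2 c (u k)" for i k
  proof -
    have "tridiagonal q' b' i k = cinner_ell2 (v i) (op_apply J (v k))"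
      using v(2) by (simp add: matrix_representation_def fun_eq_iff)
    also have "\<dots> = cnj c * c * cinner_ell2 (u i) (op_apply J (u k))"
      by (simp add: that op_apply_scale(2)[OF J] cinner_scale)
    also have "\<dots> = tridiagonal q b i k"
      using u(2) by (simp add: cc matrix_representation_def fun_eq_iff)
    finally show ?thesis .
  qed
  have "v k = scale_ell2 c (u k)" for k
  proof (induction k rule: less_induct)
    case (less k)
    show ?case
    proof (cases k)
      case 0
      then show ?thesis by (simp add: c)
    next
      case (Suc j)
      have IH: "v i = scale_ell2 c (u i)" if "i \<le> j" for i
        using less Suc that by simp
      have "q' j = q j"
        using mat[OF IH IH, of j j] by (simp add: tridiagonal_def)
      moreover have "b' (j - 1) = b (j - 1)" if "j \<noteq> 0"
        using mat[OF IH IH, of "j - 1" j] that by (cases j) (auto simp: tridiagonal_def)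
      moreover have "tri_comb q' b' v j = scale_ell2 c (tri_comb q b u j)"
        using jacobi_basis_tri_comb[OF u(1,2), of j] jacobi_basis_tri_comb[OF v(1,2), of j]
          op_apply_scale(2)[OF J, of c j] IH[of j] by simp
      ultimately have eq: "scale_ell2 (b' j) (v (Suc j)) = scale_ell2 (c * b j) (u (Suc j))"
        using IH[of j] IH[of "j - 1"]
        by (cases "j = 0") (simp_all add: tri_comb_def ell2.scale_right_distrib mult.commute)
      have "norm (scale_ell2 (b' j) (v (Suc j))) = b' j" "norm (scale_ell2 (c * b j) (u (Suc j))) = b j"
        using v(3)[of j] u(3)[of j] \<open>cmod c = 1\<close>
        by (simp_all add: norm_scale_ell2 norm_mult norm1)
      then have b: "b' j = b j" using eq by simp
      have "v (Suc j) = scale_ell2 (inverse (b j)) (scale_ell2 (b' j) (v (Suc j)))"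
        using b u(3)[of j] by simp
      also have "\<dots> = scale_ell2 c (u (Suc j))"
        unfolding eq using u(3)[of j] by simp
      finally show ?thesis using Suc by simp
    qed
  qed
  then show "v = (\<lambda>k. scale_ell2 c (u k))" by (rule ext)
qed

lemma jacobi_basis_eq_scale_delta:
  assumes J: "jacobi_operator J" "\<not> self_adjoint J" and v: "jacobi_basis J v"
  shows "\<exists>c. cmod c = 1 \<and> v = (\<lambda>k. scale_ell2 c (delta k))"
proof -
  obtain q b where b: "\<And>k. 0 < b k" and J_eq: "J = closure (jacobi_graph0 q b)"
    using J(1) by (auto simp: jacobi_operator_def)
  interpret jacobi_parameters q b
    by unfold_locales (rule b)
  \<comment> \<open>The contrapositive of \<open>self_adjoint_limit_point\<close> at \<i>.\<close>
  interpret limit_circle q b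
    using J(2) self_adjoint_limit_point[of "\<i>"] by unfold_locales (auto simp: J_eq)
  obtain q' b' where b': "\<And>k. 0 < b' k" and mat: "matrix_representation J v = tridiagonal q' b'"
    using v by (auto simp: jacobi_basis_def jacobi_matrix_def)
  have br: "basis_of_representation J v"
    using v by (simp add: jacobi_basis_def)
  obtain c where "v 0 = scale_ell2 c (delta 0)"
    using jacobi_basis_first_vector[OF br[unfolded J_eq] mat[unfolded J_eq] b'] by blast
  from jacobi_bases_proportional[OF jacobi_operator_canonical[of q b, folded J_eq] b br mat b' this]
  show ?thesis by blast
qed

theorem proposition5p10:
  fixes J :: ell2_graph
  assumes "jacobi_operator J" and "\<not> self_adjoint J"
  shows "(\<exists>u. jacobi_basis J u \<and> real_basis u \<and>
            (\<forall>v. jacobi_basis J v \<longleftrightarrow> (\<exists>c. cmod c = 1 \<and> v = (\<lambda>k. scale_ell2 c (u k)))) \<and>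
            (\<forall>v. jacobi_basis J v \<and> real_basis v \<longleftrightarrow> v = u \<or> v = reflection u)) \<and>
         (\<exists>!M. jacobi_matrix M \<and>
            (\<exists>u. basis_of_representation J u \<and> matrix_representation J u = M))"
proof (intro conjI exI[of _ delta])
  show base: "jacobi_basis J delta"
    by (rule jacobi_operator_has_jacobi_basis[OF assms(1)])
  show "real_basis delta"
    by (simp add: real_basis_def delta.rep_eq)
  have iff: "jacobi_basis J v \<longleftrightarrow> (\<exists>c. cmod c = 1 \<and> v = (\<lambda>k. scale_ell2 c (delta k)))" for v
    using jacobi_basis_eq_scale_delta[OF assms] jacobi_basis_scale(1)[OF base] by blast
  then show "\<forall>v. jacobi_basis J v \<longleftrightarrow> (\<exists>c. cmod c = 1 \<and> v = (\<lambda>k. scale_ell2 c (delta k)))"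
    by blast
  have refl: "reflection delta = (\<lambda>k. scale_ell2 (-1) (delta k))"
    by (simp add: reflection_def fun_eq_iff)
  show "\<forall>v. jacobi_basis J v \<and> real_basis v \<longleftrightarrow> v = delta \<or> v = reflection delta"
  proof (intro allI iffI)
    fix v assume v: "jacobi_basis J v \<and> real_basis v"
    then obtain c where c: "cmod c = 1" "v = (\<lambda>k. scale_ell2 c (delta k))"
      using iff by blast
    \<comment> \<open>The factor is itself a coordinate of the real basis, hence real, and a real
      unimodular number is 1 or -1.\<close>
    then have "coord (v 0) 0 = c"
      by (simp add: scale_ell2.rep_eq delta.rep_eq)
    then have "c \<in> \<real>"
      using v by (metis real_basis_def)
    then obtain r where "c = complex_of_real r" by (rule Reals_cases)
    then have "c = 1 \<or> c = -1"
      using c(1) by (auto simp: abs_if split: if_splits)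
    then show "v = delta \<or> v = reflection delta"
      using c(2) by (auto simp: refl)
  next
    fix v assume "v = delta \<or> v = reflection delta"
    moreover have "jacobi_basis J (reflection delta)"
      unfolding iff refl by (intro exI[of _ "-1"]) simp
    moreover have "real_basis (reflection delta)"
      by (simp add: real_basis_def reflection_def uminus_ell2.rep_eq delta.rep_eq)
    ultimately show "jacobi_basis J v \<and> real_basis v"
      using base \<open>real_basis delta\<close> by blast
  qed
  show "\<exists>!M. jacobi_matrix M \<and> (\<exists>u. basis_of_representation J u \<and> matrix_representation J u = M)"
  proof (rule ex1I[of _ "matrix_representation J delta"])
    show "jacobi_matrix (matrix_representation J delta) \<and>
        (\<exists>u. basis_of_representation J u \<and> matrix_representation J u = matrix_representation J delta)"
      using base by (auto simp: jacobi_basis_def)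
    fix M assume "jacobi_matrix M \<and> (\<exists>u. basis_of_representation J u \<and> matrix_representation J u = M)"
    then obtain u where u: "jacobi_basis J u" "matrix_representation J u = M"
      by (auto simp: jacobi_basis_def)
    then obtain c where "cmod c = 1" "u = (\<lambda>k. scale_ell2 c (delta k))"
      using iff by blast
    then show "M = matrix_representation J delta"
      using jacobi_basis_scale(2)[OF base] u(2) by simp
  qed
qed

end
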